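(* The pure cactus group $PJ_4$ of degree four admits the presentation \[ \left\langle g_1, \dots, g_{10} \;\middle|\; \begin{array}{l} g_{3} g_6^{-1} g_{7} g_{9}^{-1} g_{2}^{-1} = g_{3} g_{8}^{-1} g_{4}^{-1} = g_{5} g_{9}^{-1} g_{4}^{-1} \\ = g_{5} g_{1} g_{6}^{-1} = g_8 g_{10} g_7^{-1} = g_{10} g_{1}^{-1} g_{2} = e \end{array} \right\rangle , \] and this presentation can be transformed into the presentation \[ \left\langle g_2, g_4, g_8, g_9, g_{10} \;\middle|\; g_{2}g_{9}g_{10}^{-1}g_{8}^{-1}g_{4}g_{9}g_{2}g_{10}g_{8}^{-1}g_{4}^{-1} = e \right\rangle , \] so that $PJ_4$ is isomorphic to each of the two groups so presented.
   Context: For an integer $n\ge 2$, the cactus group $J_n$ is the group generated by $s_{p,q}$ for $1\le p<q\le n$ subject to the relations: (1) $s_{p,q}^2=e$ for all $1\le p<q\le n$; (2) $s_{p,q}s_{m,r}=s_{m,r}s_{p,q}$ whenever $[p,q]\cap[m,r]=\emptyset$; (3) $s_{p,q}s_{m,r}=s_{p+q-r,\,p+q-m}\,s_{p,q}$ whenever $[m,r]\subset[p,q]$. Here $[p,q]=\{p,p+1,\dots,q\}$ and $e$ is the identity. There is a natural surjective homomorphism $\pi:J_n\to S_n$ sending $s_{p,q}$ to the permutation that reverses the order of $p,p+1,\dots,q$ (i.e. $i\mapsto p+q-i$ for $i \in [p,q]$) and fixes all other elements. The pure cactus group of degree $n$ is $PJ_n=\ker \pi$. *)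

theory Defs
  imports "HOL-Algebra.Coset" "HOL-Algebra.Sym_Groups"
begin

section \<open>Groups given by generators and relations\<close>

datatype 'a letter = Pos 'a | Neg 'a

primrec inv_letter :: "'a letter \<Rightarrow> 'a letter" where
  "inv_letter (Pos x) = Neg x"
| "inv_letter (Neg x) = Pos x"

type_synonym 'a gword = "'a letter list"

definition letters :: "'a set \<Rightarrow> 'a letter set" where
  "letters X = Pos ` X \<union> Neg ` X"

definition words :: "'a set \<Rightarrow> 'a gword set" where
  "words X = lists (letters X)"

text \<open>A presentation consists of the set of generators and the set of relations; the pair
  \<open>(u, v)\<close> stands for the relation \<open>u = v\<close>, so that a relator \<open>r\<close> is the relation \<open>(r, [])\<close>.\<close>

type_synonym 'a presentation = "'a set \<times> ('a gword \<times> 'a gword) set"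

text \<open>The least congruence on the words over \<open>X\<close> that contains the free cancellations and
  the relations. Pairs of \<open>R\<close> that are not made of words over \<open>X\<close> are ignored; the
  presentations used below contain no such pairs.\<close>

inductive_set pres_rel :: "'a set \<Rightarrow> ('a gword \<times> 'a gword) set \<Rightarrow> ('a gword \<times> 'a gword) set"
  for X R where
  refl: "w \<in> words X \<Longrightarrow> (w, w) \<in> pres_rel X R"
| sym: "(u, v) \<in> pres_rel X R \<Longrightarrow> (v, u) \<in> pres_rel X R"
| trans: "(u, v) \<in> pres_rel X R \<Longrightarrow> (v, w) \<in> pres_rel X R \<Longrightarrow> (u, w) \<in> pres_rel X R"
| append: "(u, u') \<in> pres_rel X R \<Longrightarrow> (v, v') \<in> pres_rel X R \<Longrightarrow> (u @ v, u' @ v') \<in> pres_rel X R"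
| cancel: "l \<in> letters X \<Longrightarrow> ([l, inv_letter l], []) \<in> pres_rel X R"
| relation: "(u, v) \<in> R \<Longrightarrow> u \<in> words X \<Longrightarrow> v \<in> words X \<Longrightarrow> (u, v) \<in> pres_rel X R"

definition presented_group :: "'a presentation \<Rightarrow> 'a gword set monoid" where
  "presented_group = (\<lambda>(X, R).
     \<lparr>carrier = words X // pres_rel X R,
      mult = (\<lambda>A B. \<Union>u\<in>A. \<Union>v\<in>B. pres_rel X R `` {u @ v}),
      one = pres_rel X R `` {[]}\<rparr>)"

text \<open>The value of a word in a group \<open>G\<close>, given the values of the generators, and the map
  that this induces on the presented group.\<close>

primrec eval_letter :: "('g, 'm) monoid_scheme \<Rightarrow> ('a \<Rightarrow> 'g) \<Rightarrow> 'a letter \<Rightarrow> 'g" where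
  "eval_letter G f (Pos x) = f x"
| "eval_letter G f (Neg x) = inv\<^bsub>G\<^esub> (f x)"

definition eval_word :: "('g, 'm) monoid_scheme \<Rightarrow> ('a \<Rightarrow> 'g) \<Rightarrow> 'a gword \<Rightarrow> 'g" where
  "eval_word G f w = foldr (\<lambda>l a. eval_letter G f l \<otimes>\<^bsub>G\<^esub> a) w \<one>\<^bsub>G\<^esub>"

definition induced_map :: "('g, 'm) monoid_scheme \<Rightarrow> ('a \<Rightarrow> 'g) \<Rightarrow> 'a gword set \<Rightarrow> 'g" where
  "induced_map G f A = the_elem (eval_word G f ` A)"

text \<open>Tietze transformations: adding a relation that follows from the given ones, adding a
  new generator \<open>y\<close> together with a relation \<open>y = w\<close> where \<open>w\<close> does not involve \<open>y\<close>, and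
  the inverses of these two moves.\<close>

inductive tietze_move :: "'a presentation \<Rightarrow> 'a presentation \<Rightarrow> bool" where
  add_relation: "R \<subseteq> words X \<times> words X \<Longrightarrow> (u, v) \<in> pres_rel X R \<Longrightarrow>
    tietze_move (X, R) (X, insert (u, v) R)"
| add_generator: "R \<subseteq> words X \<times> words X \<Longrightarrow> y \<notin> X \<Longrightarrow> w \<in> words X \<Longrightarrow>
    tietze_move (X, R) (insert y X, insert ([Pos y], w) R)"

definition tietze_equivalent :: "'a presentation \<Rightarrow> 'a presentation \<Rightarrow> bool" where
  "tietze_equivalent = equivclp tietze_move"


subsection \<open>A presented group is a group\<close>

lemma pres_rel_words: "(u, v) \<in> pres_rel X R \<Longrightarrow> u \<in> words X \<and> v \<in> words X"
proof (induction rule: pres_rel.induct)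
  case (cancel l)
  then show ?case by (auto simp: words_def letters_def)
qed (auto simp: words_def)

lemma equiv_pres_rel: "equiv (words X) (pres_rel X R)"
  unfolding equiv_def refl_on_def sym_def trans_def
  by (meson mem_Sigma_iff pres_rel.refl pres_rel.sym pres_rel.trans pres_rel_words subrelI)

lemma words_append [simp]: "u @ v \<in> words X \<longleftrightarrow> u \<in> words X \<and> v \<in> words X"
  by (auto simp: words_def)

lemma words_Nil [simp]: "[] \<in> words X"
  by (simp add: words_def)

lemma words_Cons: "l # w \<in> words X \<longleftrightarrow> l \<in> letters X \<and> w \<in> words X"
  by (auto simp: words_def)

lemma inv_letter_letters: "l \<in> letters X \<Longrightarrow> inv_letter l \<in> letters X"
  by (auto simp: letters_def)

lemma inv_letter_inv_letter [simp]: "inv_letter (inv_letter l) = l"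
  by (cases l) auto

lemma mult_presented_group:
  assumes "u \<in> words X" "v \<in> words X"
  shows "(pres_rel X R `` {u}) \<otimes>\<^bsub>presented_group (X, R)\<^esub> (pres_rel X R `` {v})
    = pres_rel X R `` {u @ v}"
proof -
  have "congruent2 (pres_rel X R) (pres_rel X R) (\<lambda>u v. pres_rel X R `` {u @ v})"
    unfolding congruent2_def
    by (auto intro!: equiv_class_eq[OF equiv_pres_rel] pres_rel.append)
  from UN_equiv_class2[OF equiv_pres_rel equiv_pres_rel this assms]
  show ?thesis by (simp add: presented_group_def)
qed

lemma carrier_presented_group:
  "carrier (presented_group (X, R)) = (\<lambda>w. pres_rel X R `` {w}) ` words X"
  by (auto simp: presented_group_def quotient_def)

lemma one_presented_group: "\<one>\<^bsub>presented_group (X, R)\<^esub> = pres_rel X R `` {[]}"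
  by (simp add: presented_group_def)

lemma pres_rel_inverse:
  "w \<in> words X \<Longrightarrow> \<exists>w'\<in>words X. (w' @ w, []) \<in> pres_rel X R"
proof (induction w)
  case Nil
  show ?case by (rule bexI[of _ "[]"]) (simp_all add: pres_rel.refl)
next
  case (Cons l w)
  then obtain w' where w': "w' \<in> words X" "(w' @ w, []) \<in> pres_rel X R" and l: "l \<in> letters X"
    and w: "w \<in> words X"
    by (auto simp: words_Cons)
  have "([inv_letter l, l], []) \<in> pres_rel X R"
    using pres_rel.cancel[OF inv_letter_letters[OF l], where R = R] by simp
  from pres_rel.append[OF pres_rel.refl[OF w'(1)]
      pres_rel.append[OF this pres_rel.refl[OF w]]]
  have "((w' @ [inv_letter l]) @ l # w, w' @ w) \<in> pres_rel X R" by simp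
  with w' l show ?case
    by (intro bexI[of _ "w' @ [inv_letter l]"])
      (auto intro: pres_rel.trans simp: words_Cons inv_letter_letters)
qed

lemma group_presented_group: "group (presented_group P)"
proof (cases P)
  case (Pair X R)
  have "group (presented_group (X, R))"
  proof (rule groupI)
    fix A assume "A \<in> carrier (presented_group (X, R))"
    then obtain w where w: "w \<in> words X" "A = pres_rel X R `` {w}"
      by (auto simp: carrier_presented_group)
    from pres_rel_inverse[OF w(1)]
    obtain w' where w': "w' \<in> words X" "(w' @ w, []) \<in> pres_rel X R" by blast
    then show "\<exists>B\<in>carrier (presented_group (X, R)).
        B \<otimes>\<^bsub>presented_group (X, R)\<^esub> A = \<one>\<^bsub>presented_group (X, R)\<^esub>"
      using w by (intro bexI[of _ "pres_rel X R `` {w'}"])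
        (auto simp: carrier_presented_group mult_presented_group one_presented_group
          equiv_class_eq[OF equiv_pres_rel])
  qed (auto simp: carrier_presented_group mult_presented_group one_presented_group)
  with Pair show ?thesis by simp
qed

subsection \<open>The induced map is a homomorphism\<close>

context group
begin

lemma eval_letter_closed: "f \<in> X \<rightarrow> carrier G \<Longrightarrow> l \<in> letters X \<Longrightarrow> eval_letter G f l \<in> carrier G"
  by (auto simp: letters_def Pi_iff)

lemma eval_word_closed: "f \<in> X \<rightarrow> carrier G \<Longrightarrow> w \<in> words X \<Longrightarrow> eval_word G f w \<in> carrier G"
  by (induction w) (auto simp: eval_word_def words_Cons intro!: eval_letter_closed)

lemma eval_word_append:
  "f \<in> X \<rightarrow> carrier G \<Longrightarrow> u \<in> words X \<Longrightarrow> v \<in> words X \<Longrightarrow>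
    eval_word G f (u @ v) = eval_word G f u \<otimes> eval_word G f v"
proof (induction u)
  case Nil
  then show ?case using eval_word_closed[of f X v] by (simp add: eval_word_def)
next
  case (Cons l u)
  then show ?case
    using eval_word_closed[of f X v] eval_word_closed[of f X u] eval_letter_closed[of f X l]
    by (simp add: eval_word_def words_Cons m_assoc)
qed

lemma eval_word_pres_rel:
  assumes f: "f \<in> X \<rightarrow> carrier G"
    and rels: "\<And>u v. (u, v) \<in> R \<Longrightarrow> eval_word G f u = eval_word G f v"
  shows "(u, v) \<in> pres_rel X R \<Longrightarrow> eval_word G f u = eval_word G f v"
proof (induction rule: pres_rel.induct)
  case (append u u' v v')
  then show ?case using pres_rel_words[OF append(1)] pres_rel_words[OF append(2)]
    by (simp add: eval_word_append[OF f])
next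
  case (cancel l)
  then show ?case using f by (auto simp: eval_word_def letters_def Pi_iff)
next
  case (relation u v)
  then show ?case by (intro rels)
qed simp_all

lemma induced_map_class:
  assumes f: "f \<in> X \<rightarrow> carrier G"
    and rels: "\<And>u v. (u, v) \<in> R \<Longrightarrow> eval_word G f u = eval_word G f v"
    and w: "w \<in> words X"
  shows "induced_map G f (pres_rel X R `` {w}) = eval_word G f w"
proof -
  have "eval_word G f v = eval_word G f w" if "(w, v) \<in> pres_rel X R" for v
    using eval_word_pres_rel[OF f rels that] by simp
  then have "eval_word G f ` (pres_rel X R `` {w}) = {eval_word G f w}"
    using pres_rel.refl[OF w, of R] by blast
  then show ?thesis by (simp add: induced_map_def)
qed

lemma induced_map_hom:
  assumes f: "f \<in> X \<rightarrow> carrier G"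
    and rels: "\<And>u v. (u, v) \<in> R \<Longrightarrow> eval_word G f u = eval_word G f v"
  shows "induced_map G f \<in> hom (presented_group (X, R)) G"
proof -
  note on_class = induced_map_class[where R = R, OF f rels]
  show ?thesis
    by (rule homI)
      (auto simp: carrier_presented_group mult_presented_group on_class
        eval_word_append[OF f] eval_word_closed[OF f])
qed

end


section \<open>The cactus group and the pure cactus group\<close>

definition cactus_gens :: "nat \<Rightarrow> (nat \<times> nat) set" where
  "cactus_gens n = {(p, q). 1 \<le> p \<and> p < q \<and> q \<le> n}"

abbreviation s :: "nat \<Rightarrow> nat \<Rightarrow> (nat \<times> nat) letter" where
  "s p q \<equiv> Pos (p, q)"

definition cactus_rels :: "nat \<Rightarrow> ((nat \<times> nat) gword \<times> (nat \<times> nat) gword) set" where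
  "cactus_rels n =
     {([s p q, s p q], []) | p q. (p, q) \<in> cactus_gens n}
   \<union> {([s p q, s m r], [s m r, s p q]) | p q m r.
        (p, q) \<in> cactus_gens n \<and> (m, r) \<in> cactus_gens n \<and> {p..q} \<inter> {m..r} = {}}
   \<union> {([s p q, s m r], [s (p + q - r) (p + q - m), s p q]) | p q m r.
        (p, q) \<in> cactus_gens n \<and> (m, r) \<in> cactus_gens n \<and> {m..r} \<subseteq> {p..q}}"

definition cactus_group :: "nat \<Rightarrow> (nat \<times> nat) gword set monoid" where
  "cactus_group n = presented_group (cactus_gens n, cactus_rels n)"

definition reversal :: "nat \<Rightarrow> nat \<Rightarrow> nat \<Rightarrow> nat" where
  "reversal p q = (\<lambda>i. if i \<in> {p..q} then p + q - i else i)"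

definition cactus_perm :: "nat \<Rightarrow> (nat \<times> nat) gword set \<Rightarrow> nat \<Rightarrow> nat" where
  "cactus_perm n = induced_map (sym_group n) (\<lambda>(p, q). reversal p q)"

definition pure_cactus_group :: "nat \<Rightarrow> (nat \<times> nat) gword set monoid" where
  "pure_cactus_group n =
     (cactus_group n)\<lparr>carrier := kernel (cactus_group n) (sym_group n) (cactus_perm n)\<rparr>"


subsection \<open>The homomorphism to the symmetric group\<close>

lemma reversal_permutes: "(p, q) \<in> cactus_gens n \<Longrightarrow> reversal p q permutes {1..n}"
proof -
  assume pq: "(p, q) \<in> cactus_gens n"
  have inv: "reversal p q (reversal p q i) = i" for i
    by (auto simp: reversal_def)
  show ?thesis
  proof (rule bij_imp_permutes)
    have "reversal p q i \<in> {1..n}" if "i \<in> {1..n}" for i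
      using pq that by (auto simp: reversal_def cactus_gens_def)
    then show "bij_betw (reversal p q) {1..n} {1..n}"
      by (intro bij_betwI[of _ _ _ "reversal p q"]) (auto simp: inv)
    show "reversal p q i = i" if "i \<notin> {1..n}" for i
      using pq that by (auto simp: reversal_def cactus_gens_def)
  qed
qed

lemma reversal_in_sym_group:
  "(\<lambda>(p, q). reversal p q) \<in> cactus_gens n \<rightarrow> carrier (sym_group n)"
  using reversal_permutes by (auto simp: sym_group_def)

lemma cactus_rels_in_sym_group:
  assumes "(u, v) \<in> cactus_rels n"
  shows "eval_word (sym_group n) (\<lambda>(p, q). reversal p q) u
    = eval_word (sym_group n) (\<lambda>(p, q). reversal p q) v"
proof -
  have cancel: "reversal p q (reversal p q i) = i" for p q i
    by (auto simp: reversal_def)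
  have in_range: "p + q - i \<in> {p..q}" if "i \<in> {p..q}" for p q i :: nat
    using that by auto
  have commute: "reversal p q (reversal m r i) = reversal m r (reversal p q i)"
    if disj: "{p..q} \<inter> {m..r} = {}" for p q m r i
  proof -
    consider "i \<in> {p..q}" "i \<notin> {m..r}" | "i \<notin> {p..q}" "i \<in> {m..r}" | "i \<notin> {p..q}" "i \<notin> {m..r}"
      using disj by blast
    then show ?thesis
    proof cases
      case 1
      with in_range[of i p q] disj have "p + q - i \<notin> {m..r}" by blast
      with 1 show ?thesis unfolding reversal_def by (simp only: if_True if_False)
    next
      case 2
      with in_range[of i m r] disj have "m + r - i \<notin> {p..q}" by blast
      with 2 show ?thesis unfolding reversal_def by (simp only: if_True if_False)
    next
      case 3
      then show ?thesis unfolding reversal_def by (simp only: if_False)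
    qed
  qed
  have nested: "reversal p q (reversal m r i)
      = reversal (p + q - r) (p + q - m) (reversal p q i)"
    if sub: "{m..r} \<subseteq> {p..q}" and "m < r" for p q m r i
  proof -
    have mr: "p \<le> m" "m < r" "r \<le> q" using that by auto
    consider "i \<in> {m..r}" | "i \<in> {p..q}" "i \<notin> {m..r}" | "i \<notin> {p..q}" by blast
    then show ?thesis
    proof cases
      case 1
      with sub have i: "i \<in> {p..q}" by blast
      with in_range[OF 1] sub have "m + r - i \<in> {p..q}" by blast
      moreover have "p + q - i \<in> {p + q - r..p + q - m}" using 1 mr by auto
      moreover have "p + q - (m + r - i) = (p + q - r) + (p + q - m) - (p + q - i)"
        using 1 mr by simp
      ultimately show ?thesis using 1 i unfolding reversal_def by (simp only: if_True)
    next
      case 2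
      have "p + q - i \<notin> {p + q - r..p + q - m}" using 2 mr by auto
      then show ?thesis using 2 unfolding reversal_def by (simp only: if_True if_False)
    next
      case 3
      have "i \<notin> {m..r}" using 3 sub by blast
      moreover have "i \<notin> {p + q - r..p + q - m}" using 3 mr by auto
      ultimately show ?thesis using 3 unfolding reversal_def by (simp only: if_False)
    qed
  qed
  consider (square) p q where "u = [s p q, s p q]" "v = []"
    | (disjoint) p q m r where "u = [s p q, s m r]" "v = [s m r, s p q]" "{p..q} \<inter> {m..r} = {}"
    | (contained) p q m r where "u = [s p q, s m r]"
        "v = [s (p + q - r) (p + q - m), s p q]" "{m..r} \<subseteq> {p..q}" "m < r"
    using assms unfolding cactus_rels_def cactus_gens_def Un_iff mem_Collect_eq case_prod_conv
    by (elim disjE exE conjE) (simp_all only: prod.inject)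
  then show ?thesis
  proof cases
    case square
    then show ?thesis by (simp add: eval_word_def sym_group_def fun_eq_iff cancel)
  next
    case disjoint
    then show ?thesis
      using commute[OF disjoint(3)] by (simp add: eval_word_def sym_group_def fun_eq_iff)
  next
    case contained
    then show ?thesis
      using nested[OF contained(3,4)] by (simp add: eval_word_def sym_group_def fun_eq_iff)
  qed
qed

lemma cactus_perm_hom: "cactus_perm n \<in> hom (cactus_group n) (sym_group n)"
  unfolding cactus_perm_def cactus_group_def
  by (rule group.induced_map_hom[OF sym_group_is_group reversal_in_sym_group
        cactus_rels_in_sym_group])

lemma cactus_group_hom: "group_hom (cactus_group n) (sym_group n) (cactus_perm n)"
  using group_presented_group[of "(cactus_gens n, cactus_rels n)"] cactus_perm_hom
  by (intro group_hom.intro group_hom_axioms.intro sym_group_is_group)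
    (simp_all only: cactus_group_def)

lemma cactus_perm_generator:
  assumes "(p, q) \<in> cactus_gens n"
  shows "cactus_perm n (pres_rel (cactus_gens n) (cactus_rels n) `` {[s p q]}) = reversal p q"
proof -
  have "[s p q] \<in> words (cactus_gens n)"
    using assms by (auto simp: words_Cons letters_def)
  then show ?thesis
    unfolding cactus_perm_def
    by (subst group.induced_map_class[OF sym_group_is_group reversal_in_sym_group
          cactus_rels_in_sym_group]) (auto simp: eval_word_def sym_group_def)
qed

lemma cactus_perm_surj: "cactus_perm n ` carrier (cactus_group n) = carrier (sym_group n)"
proof
  show "cactus_perm n ` carrier (cactus_group n) \<subseteq> carrier (sym_group n)"
    using cactus_perm_hom by (auto simp: hom_def)
next
  interpret group_hom "cactus_group n" "sym_group n" "cactus_perm n"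
    by (rule cactus_group_hom)
  let ?I = "cactus_perm n ` carrier (cactus_group n)"
  have comp: "x \<circ> y \<in> ?I" if "x \<in> ?I" "y \<in> ?I" for x y
  proof -
    from that(1) obtain a where a: "x = cactus_perm n a" "a \<in> carrier (cactus_group n)"
      by (rule imageE)
    from that(2) obtain b where b: "y = cactus_perm n b" "b \<in> carrier (cactus_group n)"
      by (rule imageE)
    from a b have "x \<circ> y = cactus_perm n (a \<otimes>\<^bsub>cactus_group n\<^esub> b)"
      by (simp add: sym_group_mult)
    then show ?thesis by (rule image_eqI) (intro G.m_closed a b)
  qed
  have id_in: "id \<in> ?I"
    using imageI[OF G.one_closed, of "cactus_perm n"] by (simp add: sym_group_one)
  have rev: "reversal p q \<in> ?I" if "(p, q) \<in> cactus_gens n" for p q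
  proof -
    have "[s p q] \<in> words (cactus_gens n)"
      using that by (auto simp: words_Cons letters_def)
    then have "pres_rel (cactus_gens n) (cactus_rels n) `` {[s p q]} \<in> carrier (cactus_group n)"
      unfolding cactus_group_def carrier_presented_group by (rule imageI)
    from imageI[OF this, of "cactus_perm n"] show ?thesis
      unfolding cactus_perm_generator[OF that] .
  qed
  have less: "Transposition.transpose a b \<in> ?I" if "a \<in> {1..n}" "b \<in> {1..n}" "a < b" for a b
  proof (cases "a + 1 < b - 1")
    case True
    have gens: "(a, b) \<in> cactus_gens n" "(a + 1, b - 1) \<in> cactus_gens n"
      using that True by (auto simp: cactus_gens_def)
    have "Transposition.transpose a b i = reversal a b (reversal (a + 1) (b - 1) i)" for i
    proof -
      consider "i < a" | "i = a" | "a < i" "i < b" | "i = b" | "b < i" by linarith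
      then show ?thesis
        using that True by cases (auto simp: reversal_def)
    qed
    then have "Transposition.transpose a b = reversal a b \<circ> reversal (a + 1) (b - 1)"
      by (simp add: fun_eq_iff)
    with comp[OF rev[OF gens(1)] rev[OF gens(2)]] show ?thesis by simp
  next
    case False
    have gens: "(a, b) \<in> cactus_gens n"
      using that by (auto simp: cactus_gens_def)
    have "b = a + 1 \<or> b = a + 2" using that False by linarith
    then have "Transposition.transpose a b i = reversal a b i" for i
    proof -
      consider "i < a" | "i = a" | "i = a + 1" | "i = a + 2" | "a + 2 < i" by linarith
      then show ?thesis
        using \<open>b = a + 1 \<or> b = a + 2\<close> by cases (auto simp: reversal_def)
    qed
    then have "Transposition.transpose a b = reversal a b"
      by (simp add: fun_eq_iff)
    with rev[OF gens] show ?thesis by simp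
  qed
  have transp: "Transposition.transpose a b \<in> ?I"
    if "a \<in> {1..n}" "b \<in> {1..n}" "a \<noteq> b" for a b
  proof (cases "a < b")
    case True
    with that show ?thesis by (intro less)
  next
    case False
    with that have "b < a" by simp
    with that show ?thesis by (subst transpose_commute) (intro less)
  qed
  show "carrier (sym_group n) \<subseteq> ?I"
  proof
    fix p assume "p \<in> carrier (sym_group n)"
    then have "p permutes {1..n}" by (simp add: sym_group_carrier)
    from this finite_atLeastAtMost show "p \<in> ?I"
    proof (induction rule: permutes_induct)
      case id
      show ?case by (rule id_in)
    next
      case (swap a b p)
      show ?case by (intro comp transp) (fact swap)+
    qed
  qed
qed

lemma group_pure_cactus_group: "group (pure_cactus_group n)"
proof -
  interpret group_hom "cactus_group n" "sym_group n" "cactus_perm n"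
    by (rule cactus_group_hom)
  show ?thesis
    unfolding pure_cactus_group_def by (rule G.subgroup_imp_group[OF subgroup_kernel])
qed


section \<open>The two presentations\<close>

abbreviation g :: "nat \<Rightarrow> nat letter" where
  "g i \<equiv> Pos i"

abbreviation g_inv :: "nat \<Rightarrow> nat letter" where
  "g_inv i \<equiv> Neg i"

definition ten_generator_presentation :: "nat presentation" where
  "ten_generator_presentation =
     ({1..10},
      {([g 3, g_inv 6, g 7, g_inv 9, g_inv 2], []),
       ([g 3, g_inv 8, g_inv 4], []),
       ([g 5, g_inv 9, g_inv 4], []),
       ([g 5, g 1, g_inv 6], []),
       ([g 8, g 10, g_inv 7], []),
       ([g 10, g_inv 1, g 2], [])})"

definition one_relator_presentation :: "nat presentation" where
  "one_relator_presentation =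
     ({2, 4, 8, 9, 10},
      {([g 2, g 9, g_inv 10, g_inv 8, g 4, g 9, g 2, g 10, g_inv 8, g_inv 4], [])})"

end

theory Submission
  imports Defs
begin

text \<open>The cactus group acts on the 24 cosets of \<open>PJ\<^sub>4\<close>, and the Reidemeister--Schreier method turns a
  table of representatives and of Schreier generators, written in the generators of the
  one-relator presentation, into an isomorphism. \<open>PJ\<^sub>4\<close> is the fundamental group of a closed
  nonorientable surface of Euler characteristic \<open>-3\<close> tiled by twelve pentagons; gluing them to a
  ten-gon gives the table. In the surface group every relation that has to be
  verified is then a free consequence or a cyclic conjugate of the relator. The five other
  generators of the first presentation are eliminated one by one with the five relators of
  length three, which turns the relator of length five into an inverse conjugate of the single relator.\<close>

section \<open>Words modulo a presentation\<close>

text \<open>In each pentagon the sides follow in the cyclic order \<open>s 1 2\<close>,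
  \<open>s 3 4\<close>, \<open>s 2 4\<close>, \<open>s 2 3\<close>, \<open>s 1 3\<close>; neighbours
  are exactly the pairs with disjoint or nested intervals. The relation of such a pair is a closed
  path around a vertex where four pentagons meet, which gives 12 faces, 30 edges and 15 vertices. A
  ten-gon with sides glued in pairs has one face and five edges, and characteristic -3 leaves one
  vertex: hence five generators, each occurring twice in the relator. The topology is not a premise
  of any step. What has to be shown about the tables are equations in two groups whose word problems
  are not solved here, so both tests are one-sided: a positive answer yields a derivation, a
  negative one means nothing. The tables are chosen so that these weak tests suffice.\<close>

definition inv_word :: "'a gword \<Rightarrow> 'a gword" where
  "inv_word w = rev (map inv_letter w)"

lemma inv_word_Nil [simp]: "inv_word [] = []"
  by (simp add: inv_word_def)

lemma inv_word_Cons [simp]: "inv_word (l # w) = inv_word w @ [inv_letter l]"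
  by (simp add: inv_word_def)

lemma inv_word_append [simp]: "inv_word (u @ v) = inv_word v @ inv_word u"
  by (simp add: inv_word_def)

lemma inv_word_inv_word [simp]: "inv_word (inv_word w) = w"
  by (induction w) auto

lemma inv_word_words [simp]: "inv_word w \<in> words X \<longleftrightarrow> w \<in> words X"
proof -
  have "inv_word w \<in> words X" if "w \<in> words X" for w :: "'a gword"
    using that by (induction w) (auto simp: words_Cons inv_letter_letters)
  from this[of w] this[of "inv_word w"] show ?thesis by auto
qed

lemma letters_simps [simp]:
  "Pos x \<in> letters X \<longleftrightarrow> x \<in> X"
  "Neg x \<in> letters X \<longleftrightarrow> x \<in> X"
  by (auto simp: letters_def)

lemma words_mono: "X \<subseteq> Y \<Longrightarrow> w \<in> words X \<Longrightarrow> w \<in> words Y"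
  by (induction w) (auto simp: words_Cons letters_def)

lemma pres_rel_inv_right: "w \<in> words X \<Longrightarrow> (w @ inv_word w, []) \<in> pres_rel X R"
proof (induction w)
  case Nil
  then show ?case by (simp add: pres_rel.refl)
next
  case (Cons l w)
  then have l: "l \<in> letters X" and "(w @ inv_word w, []) \<in> pres_rel X R"
    by (auto simp: words_Cons)
  then have "([l] @ (w @ inv_word w) @ [inv_letter l], [l] @ [] @ [inv_letter l]) \<in> pres_rel X R"
    by (intro pres_rel.append pres_rel.refl) (auto simp: words_Cons inv_letter_letters)
  then show ?case
    using pres_rel.cancel[OF l] by (auto intro: pres_rel.trans)
qed

lemma pres_rel_inv_left: "w \<in> words X \<Longrightarrow> (inv_word w @ w, []) \<in> pres_rel X R"
  using pres_rel_inv_right[of "inv_word w"] by simp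

lemma pres_rel_trans3:
  "(u, v) \<in> pres_rel X R \<Longrightarrow> (u, u') \<in> pres_rel X R \<Longrightarrow> (v, v') \<in> pres_rel X R \<Longrightarrow>
    (u', v') \<in> pres_rel X R"
  by (rule pres_rel.trans[OF pres_rel.trans[OF pres_rel.sym]])

lemma pres_rel_cancel_left:
  assumes "(u @ v, u @ w) \<in> pres_rel X R"
  shows "(v, w) \<in> pres_rel X R"
proof -
  have u: "u \<in> words X" and v: "v \<in> words X" and w: "w \<in> words X"
    using pres_rel_words[OF assms] by auto
  have "inv_word u \<in> words X" using u by simp
  from pres_rel.append[OF pres_rel.refl[OF this] assms]
  have "(inv_word u @ u @ v, inv_word u @ u @ w) \<in> pres_rel X R" .
  moreover have "((inv_word u @ u) @ x, [] @ x) \<in> pres_rel X R" if "x \<in> words X" for x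
    using pres_rel_inv_left[OF u] pres_rel.refl[OF that] by (rule pres_rel.append)
  from this[OF v] this[OF w] have "(inv_word u @ u @ v, v) \<in> pres_rel X R"
    "(inv_word u @ u @ w, w) \<in> pres_rel X R" by simp_all
  ultimately show ?thesis by (rule pres_rel_trans3)
qed

lemma pres_rel_split_right:
  assumes "(u @ v, []) \<in> pres_rel X R"
  shows "(v, inv_word u) \<in> pres_rel X R"
proof -
  have "u \<in> words X" using pres_rel_words[OF assms] by auto
  from pres_rel.trans[OF assms pres_rel.sym[OF pres_rel_inv_right[OF this]]]
  show ?thesis by (rule pres_rel_cancel_left)
qed

text \<open>If \<open>u @ v\<close> is trivial, then \<open>v\<close> is the inverse of
  \<open>u\<close> and cancels it on the other side too.\<close>

lemma pres_rel_conj: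
  assumes "(u @ v, []) \<in> pres_rel X R"
  shows "(v @ u, []) \<in> pres_rel X R"
proof -
  have u: "u \<in> words X" using pres_rel_words[OF assms] by auto
  have "(v @ u, inv_word u @ u) \<in> pres_rel X R"
    by (intro pres_rel.append pres_rel_split_right[OF assms] pres_rel.refl u)
  then show ?thesis using pres_rel_inv_left[OF u] by (rule pres_rel.trans)
qed

lemma pres_rel_split_left:
  "(u @ v, []) \<in> pres_rel X R \<Longrightarrow> (u, inv_word v) \<in> pres_rel X R"
  by (blast intro: pres_rel_split_right pres_rel_conj)

lemma pres_rel_inv_word:
  assumes "(u, v) \<in> pres_rel X R"
  shows "(inv_word u, inv_word v) \<in> pres_rel X R"
proof -
  have v: "v \<in> words X" using pres_rel_words[OF assms] by simp
  have "(u @ inv_word v, v @ inv_word v) \<in> pres_rel X R"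
    using assms v by (intro pres_rel.append pres_rel.refl) auto
  then have "(u @ inv_word v, []) \<in> pres_rel X R"
    using pres_rel_inv_right[OF v] by (rule pres_rel.trans)
  from pres_rel.sym[OF pres_rel_split_right[OF this]] show ?thesis .
qed

text \<open>The evaluated tests recognise only trivial words, so every equation to be verified is
  first turned into a relator.\<close>

lemma pres_rel_iff_relator:
  assumes "u \<in> words X" "v \<in> words X"
  shows "(u, v) \<in> pres_rel X R \<longleftrightarrow> (u @ inv_word v, []) \<in> pres_rel X R"
proof
  assume "(u, v) \<in> pres_rel X R"
  then have "(u @ inv_word v, v @ inv_word v) \<in> pres_rel X R"
    using assms by (intro pres_rel.append pres_rel.refl) auto
  then show "(u @ inv_word v, []) \<in> pres_rel X R"
    using pres_rel_inv_right[OF assms(2)] by (rule pres_rel.trans)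
next
  assume "(u @ inv_word v, []) \<in> pres_rel X R"
  from pres_rel_split_left[OF this] show "(u, v) \<in> pres_rel X R" by simp
qed

lemma pres_rel_rotate:
  assumes "(r, []) \<in> pres_rel X R"
  shows "(rotate k r, []) \<in> pres_rel X R"
proof -
  have "(take (k mod length r) r @ drop (k mod length r) r, []) \<in> pres_rel X R"
    using assms by simp
  from pres_rel_conj[OF this] show ?thesis by (simp add: rotate_drop_take)
qed

lemma pres_rel_subset:
  assumes sub: "X \<subseteq> X'" and rels: "\<And>u v. (u, v) \<in> R \<Longrightarrow> u \<in> words X \<Longrightarrow> v \<in> words X
      \<Longrightarrow> (u, v) \<in> pres_rel X' R'"
  shows "(u, v) \<in> pres_rel X R \<Longrightarrow> (u, v) \<in> pres_rel X' R'"
proof (induction rule: pres_rel.induct)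
  case (cancel l)
  then show ?case using sub by (intro pres_rel.cancel) (auto simp: letters_def)
qed (use words_mono[OF sub] rels in \<open>auto intro: pres_rel.intros\<close>)

lemma class_eq_iff:
  "u \<in> words X \<Longrightarrow> v \<in> words X \<Longrightarrow>
    pres_rel X R `` {u} = pres_rel X R `` {v} \<longleftrightarrow> (u, v) \<in> pres_rel X R"
  by (rule eq_equiv_class_iff[OF equiv_pres_rel])

lemma inv_presented_group:
  assumes "w \<in> words X"
  shows "inv\<^bsub>presented_group (X, R)\<^esub> (pres_rel X R `` {w}) = pres_rel X R `` {inv_word w}"
proof -
  have "pres_rel X R `` {inv_word w @ w} = pres_rel X R `` {[]}"
    using assms by (simp add: class_eq_iff pres_rel_inv_left)
  then have "pres_rel X R `` {inv_word w} \<otimes>\<^bsub>presented_group (X, R)\<^esub> pres_rel X R `` {w}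
      = \<one>\<^bsub>presented_group (X, R)\<^esub>"
    using assms by (simp add: mult_presented_group one_presented_group)
  then show ?thesis
    by (rule group.inv_equality[OF group_presented_group])
      (use assms in \<open>auto simp: carrier_presented_group\<close>)
qed


section \<open>Substitution of words for generators\<close>

primrec subst_letter :: "('b \<Rightarrow> 'a gword) \<Rightarrow> 'b letter \<Rightarrow> 'a gword" where
  "subst_letter f (Pos y) = f y"
| "subst_letter f (Neg y) = inv_word (f y)"

definition subst_word :: "('b \<Rightarrow> 'a gword) \<Rightarrow> 'b gword \<Rightarrow> 'a gword" where
  "subst_word f w = concat (map (subst_letter f) w)"

lemma subst_word_simps [simp]:
  "subst_word f [] = []"
  "subst_word f (l # w) = subst_letter f l @ subst_word f w"
  "subst_word f (u @ v) = subst_word f u @ subst_word f v"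
  by (simp_all add: subst_word_def)

lemma subst_letter_inv_letter: "subst_letter f (inv_letter l) = inv_word (subst_letter f l)"
  by (cases l) auto

lemma subst_word_words:
  assumes "\<And>y. y \<in> Y \<Longrightarrow> f y \<in> words X"
  shows "w \<in> words Y \<Longrightarrow> subst_word f w \<in> words X"
  using assms by (induction w) (auto simp: words_Cons letters_def)

lemma subst_word_Pos: "subst_word (\<lambda>x. [Pos x]) w = w"
proof (induction w)
  case (Cons l w)
  then show ?case by (cases l) auto
qed simp

lemma subst_word_cong:
  assumes "w \<in> words Y" "\<And>y. y \<in> Y \<Longrightarrow> f y = f' y"
  shows "subst_word f w = subst_word f' w"
  using assms by (induction w) (auto simp: words_Cons letters_def)

text \<open>Homomorphisms into a presented group become substitutions, so that later arguments can
  stay with words and \<open>pres_rel\<close>.\<close>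

lemma eval_word_presented_group:
  assumes f: "\<And>y. y \<in> Y \<Longrightarrow> f y \<in> words X"
  shows "w \<in> words Y \<Longrightarrow>
    eval_word (presented_group (X, R)) (\<lambda>y. pres_rel X R `` {f y}) w
      = pres_rel X R `` {subst_word f w}"
proof (induction w)
  case Nil
  show ?case by (simp add: eval_word_def one_presented_group)
next
  case (Cons l w)
  then have l: "l \<in> letters Y" and w: "w \<in> words Y" by (auto simp: words_Cons)
  have "subst_letter f l \<in> words X" using l f by (auto simp: letters_def)
  moreover have "eval_letter (presented_group (X, R)) (\<lambda>y. pres_rel X R `` {f y}) l
      = pres_rel X R `` {subst_letter f l}"
    using l f by (auto simp: letters_def inv_presented_group)
  ultimately show ?case
    using Cons.IH[OF w] subst_word_words[OF f w]
    by (simp add: eval_word_def mult_presented_group)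
qed


section \<open>Presentations of subgroups\<close>

text \<open>This is the Reidemeister rewriting process, a cocycle for the action rather than a
  homomorphism: the label of a suffix depends on the coset reached before it.\<close>

primrec label_word :: "('c \<Rightarrow> 'a letter \<Rightarrow> 'c) \<Rightarrow> ('c \<Rightarrow> 'a letter \<Rightarrow> 'b gword) \<Rightarrow> 'c \<Rightarrow> 'a gword \<Rightarrow> 'b gword"
  where
  "label_word act label c [] = []"
| "label_word act label c (l # w) = label c l @ label_word act label (act c l) w"

lemma label_word_append:
  "label_word act label c (u @ v) = label_word act label c u @ label_word act label (foldl act c u) v"
  by (induction u arbitrary: c) auto

text \<open>The Reidemeister--Schreier data of a subgroup: \<open>act\<close> is the action of the letters on the
  set \<open>C\<close> of cosets, \<open>t c\<close> is the representative of the coset \<open>c\<close>, and \<open>label c l\<close> is the word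
  in the new generators \<open>Y\<close> that stands for the Schreier generator
  \<open>t c \<cdot> l \<cdot> (t (act c l))\<inverse>\<close>. The generator \<open>y\<close> of the subgroup is the word \<open>loop y\<close>.\<close>

locale reidemeister_schreier =
  fixes X :: "'a set" and R :: "('a gword \<times> 'a gword) set"
    and Y :: "'b set" and Q :: "('b gword \<times> 'b gword) set"
    and C :: "'c set" and c0 :: 'c
    and act :: "'c \<Rightarrow> 'a letter \<Rightarrow> 'c" and label :: "'c \<Rightarrow> 'a letter \<Rightarrow> 'b gword"
    and t :: "'c \<Rightarrow> 'a gword" and loop :: "'b \<Rightarrow> 'a gword"
  assumes base_coset: "c0 \<in> C" "t c0 = []"
    and act_closed: "\<And>c l. c \<in> C \<Longrightarrow> l \<in> letters X \<Longrightarrow> act c l \<in> C"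
    and label_closed: "\<And>c l. c \<in> C \<Longrightarrow> l \<in> letters X \<Longrightarrow> label c l \<in> words Y"
    and rep_closed: "\<And>c. c \<in> C \<Longrightarrow> t c \<in> words X"
    and rels_words: "Q \<subseteq> words Y \<times> words Y"
    and loop_closed: "\<And>y. y \<in> Y \<Longrightarrow> loop y \<in> words X"
    and act_inv: "\<And>c l. c \<in> C \<Longrightarrow> l \<in> letters X \<Longrightarrow> act (act c l) (inv_letter l) = c"
    and label_inv: "\<And>c l. c \<in> C \<Longrightarrow> l \<in> letters X \<Longrightarrow>
      (label c l @ label (act c l) (inv_letter l), []) \<in> pres_rel Y Q"
    and act_rel: "\<And>c u v. c \<in> C \<Longrightarrow> (u, v) \<in> R \<Longrightarrow> foldl act c u = foldl act c v"
    and label_rel: "\<And>c u v. c \<in> C \<Longrightarrow> (u, v) \<in> R \<Longrightarrow>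
      (label_word act label c u, label_word act label c v) \<in> pres_rel Y Q"
    and loop_rel: "\<And>u v. (u, v) \<in> Q \<Longrightarrow> (subst_word loop u, subst_word loop v) \<in> pres_rel X R"
    and coset_rep: "\<And>c l. c \<in> C \<Longrightarrow> l \<in> letters X \<Longrightarrow>
      (t c @ [l], subst_word loop (label c l) @ t (act c l)) \<in> pres_rel X R"
    and run_loop: "\<And>y. y \<in> Y \<Longrightarrow> foldl act c0 (loop y) = c0"
    and label_loop: "\<And>y. y \<in> Y \<Longrightarrow> (label_word act label c0 (loop y), [Pos y]) \<in> pres_rel Y Q"
begin

abbreviation run :: "'c \<Rightarrow> 'a gword \<Rightarrow> 'c" where
  "run \<equiv> foldl act"

abbreviation lab :: "'c \<Rightarrow> 'a gword \<Rightarrow> 'b gword" where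
  "lab \<equiv> label_word act label"

lemma run_closed: "c \<in> C \<Longrightarrow> w \<in> words X \<Longrightarrow> run c w \<in> C"
  by (induction w arbitrary: c) (auto simp: words_Cons act_closed)

lemma lab_closed: "c \<in> C \<Longrightarrow> w \<in> words X \<Longrightarrow> lab c w \<in> words Y"
  by (induction w arbitrary: c) (auto simp: words_Cons act_closed label_closed)

text \<open>Cancellations and relations generate the congruence, and the locale verifies both at
  every coset, because a relation may be applied in the middle of a path.\<close>

lemma run_lab_cong:
  "(u, v) \<in> pres_rel X R \<Longrightarrow> c \<in> C \<Longrightarrow> run c u = run c v \<and> (lab c u, lab c v) \<in> pres_rel Y Q"
proof (induction arbitrary: c rule: pres_rel.induct)
  case (refl w)
  then show ?case by (simp add: pres_rel.refl lab_closed)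
next
  case (sym u v)
  from sym.IH[OF sym.prems] show ?case by (auto intro: pres_rel.sym)
next
  case (trans u v w)
  from trans.IH(1)[OF trans.prems] trans.IH(2)[OF trans.prems] show ?case
    by (auto intro: pres_rel.trans)
next
  case (append u u' v v')
  have "run c u' \<in> C"
    using pres_rel_words[OF append(1)] append.prems by (simp add: run_closed)
  note 1 = append.IH(1)[OF append.prems] and 2 = append.IH(2)[OF this]
  from pres_rel.append[OF conjunct2[OF 1] conjunct2[OF 2]] 1 2 show ?case
    by (simp add: label_word_append)
next
  case (cancel l)
  then show ?case by (simp add: act_inv label_inv)
next
  case (relation u v)
  then show ?case by (simp add: act_rel label_rel)
qed

lemma subst_loop_closed: "w \<in> words Y \<Longrightarrow> subst_word loop w \<in> words X"
  by (rule subst_word_words[OF loop_closed])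

lemma run_lab_loop:
  "l \<in> letters Y \<Longrightarrow> run c0 (subst_letter loop l) = c0
    \<and> (lab c0 (subst_letter loop l), [l]) \<in> pres_rel Y Q"
proof (cases l)
  case (Neg y)
  moreover assume "l \<in> letters Y"
  ultimately have y: "y \<in> Y" by simp
  \<comment> \<open>The loop followed by its inverse has a trivial label, which forces the label of
    the inverse loop to be the inverse of the label of the loop.\<close>
  from run_lab_cong[OF pres_rel_inv_right[OF loop_closed[OF y]] base_coset(1)] run_loop[OF y]
  have "run c0 (inv_word (loop y)) = c0"
    "(lab c0 (loop y) @ lab c0 (inv_word (loop y)), []) \<in> pres_rel Y Q"
    by (simp_all add: label_word_append)
  moreover from pres_rel_split_right[OF this(2)] pres_rel_inv_word[OF label_loop[OF y]]
  have "(lab c0 (inv_word (loop y)), inv_word [Pos y]) \<in> pres_rel Y Q"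
    by (rule pres_rel.trans)
  ultimately show ?thesis using Neg by simp
qed (simp add: run_loop label_loop)

text \<open>Reading labels from \<open>c0\<close> is thus a left inverse of the substitution
  \<open>loop\<close>: every loop ends in \<open>c0\<close>, where the next one starts.\<close>

lemma run_lab_subst:
  "w \<in> words Y \<Longrightarrow> run c0 (subst_word loop w) = c0
    \<and> (lab c0 (subst_word loop w), w) \<in> pres_rel Y Q"
proof (induction w)
  case Nil
  then show ?case by (simp add: pres_rel.refl)
next
  case (Cons l w)
  then have l: "l \<in> letters Y" and w: "w \<in> words Y" by (auto simp: words_Cons)
  note IH = Cons.IH[OF w] and head = run_lab_loop[OF l]
  from pres_rel.append[OF conjunct2[OF head] conjunct2[OF IH]]
  show ?case by (simp only: subst_word_simps foldl_append label_word_append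
        conjunct1[OF IH] conjunct1[OF head] append_Cons append_Nil simp_thms)
qed

text \<open>The identity \<open>coset_rep\<close> telescopes along the word: the representative left
  over by one letter is used up by the next.\<close>

lemma coset_rep_word:
  "c \<in> C \<Longrightarrow> w \<in> words X \<Longrightarrow>
    (t c @ w, subst_word loop (lab c w) @ t (run c w)) \<in> pres_rel X R"
proof (induction w arbitrary: c)
  case Nil
  then show ?case by (simp add: pres_rel.refl rep_closed)
next
  case (Cons l w)
  then have l: "l \<in> letters X" and w: "w \<in> words X" by (auto simp: words_Cons)
  let ?v = "subst_word loop (label c l)"
  have v: "?v \<in> words X" using Cons.prems l by (simp add: subst_loop_closed label_closed)
  from pres_rel.append[OF coset_rep[OF Cons.prems(1) l] pres_rel.refl[OF w]]
  have "(t c @ l # w, ?v @ t (act c l) @ w) \<in> pres_rel X R" by simp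
  also from pres_rel.append[OF pres_rel.refl[OF v] Cons.IH[OF act_closed[OF Cons.prems(1) l] w]]
  have "(?v @ t (act c l) @ w,
      ?v @ subst_word loop (lab (act c l) w) @ t (run (act c l) w)) \<in> pres_rel X R" .
  finally (pres_rel.trans) show ?case by simp
qed

text \<open>Injectivity follows from the left inverse in \<open>run_lab_subst\<close>. Surjectivity
  is \<open>coset_rep_word\<close> at \<open>c0\<close>, where the representatives at both ends are
  empty.\<close>

lemma iso_stabilizer:
  "presented_group (Y, Q) \<cong> (presented_group (X, R))
    \<lparr>carrier := (\<lambda>w. pres_rel X R `` {w}) ` {w \<in> words X. run c0 w = c0}\<rparr>"
proof -
  let ?G = "presented_group (X, R)" and ?H = "presented_group (Y, Q)"
  let ?f = "\<lambda>y. pres_rel X R `` {loop y}"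
  let ?h = "induced_map ?G ?f"
  let ?K = "(\<lambda>w. pres_rel X R `` {w}) ` {w \<in> words X. run c0 w = c0}"
  have f: "?f \<in> Y \<rightarrow> carrier ?G" by (auto simp: carrier_presented_group loop_closed)
  have ev: "eval_word ?G ?f w = pres_rel X R `` {subst_word loop w}" if "w \<in> words Y" for w
    by (rule eval_word_presented_group[OF loop_closed that])
  have rels: "eval_word ?G ?f u = eval_word ?G ?f v" if "(u, v) \<in> Q" for u v
  proof -
    have "u \<in> words Y" "v \<in> words Y" using that rels_words by auto
    with loop_rel[OF that] show ?thesis by (simp add: ev class_eq_iff subst_loop_closed)
  qed
  have h: "?h (pres_rel Y Q `` {w}) = pres_rel X R `` {subst_word loop w}"
    if "w \<in> words Y" for w
    using group.induced_map_class[where R = Q, OF group_presented_group f rels that] ev[OF that]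
    by simp
  have hom: "?h \<in> hom ?H ?G"
    by (rule group.induced_map_hom[where R = Q, OF group_presented_group f rels])
  have inj: "inj_on ?h (carrier ?H)"
  proof (rule inj_onI)
    fix A B assume "A \<in> carrier ?H" "B \<in> carrier ?H" and eq: "?h A = ?h B"
    then obtain u v where u: "u \<in> words Y" "A = pres_rel Y Q `` {u}"
      and v: "v \<in> words Y" "B = pres_rel Y Q `` {v}"
      by (auto simp: carrier_presented_group)
    with eq have "(subst_word loop u, subst_word loop v) \<in> pres_rel X R"
      by (simp add: h class_eq_iff subst_loop_closed)
    from pres_rel_trans3[OF conjunct2[OF run_lab_cong[OF this base_coset(1)]]
        conjunct2[OF run_lab_subst[OF u(1)]] conjunct2[OF run_lab_subst[OF v(1)]]]
    have "(u, v) \<in> pres_rel Y Q" .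
    then show "A = B" using u v by (simp add: class_eq_iff)
  qed
  have surj: "?h ` carrier ?H = ?K"
  proof
    show "?h ` carrier ?H \<subseteq> ?K"
      using run_lab_subst subst_loop_closed by (fastforce simp: carrier_presented_group h)
    show "?K \<subseteq> ?h ` carrier ?H"
    proof
      fix A assume "A \<in> ?K"
      then obtain w where w: "w \<in> words X" "run c0 w = c0" "A = pres_rel X R `` {w}" by auto
      have lab: "lab c0 w \<in> words Y" by (rule lab_closed[OF base_coset(1) w(1)])
      have "(w, subst_word loop (lab c0 w)) \<in> pres_rel X R"
        using coset_rep_word[OF base_coset(1) w(1)] w(2) base_coset(2) by simp
      then have "A = ?h (pres_rel Y Q `` {lab c0 w})"
        using w lab by (simp add: h class_eq_iff subst_loop_closed)
      then show "A \<in> ?h ` carrier ?H" using lab by (auto simp: carrier_presented_group)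
    qed
  qed
  have "?h \<in> iso ?H (?G\<lparr>carrier := ?K\<rparr>)"
    using hom inj surj by (auto simp: iso_def hom_def bij_betw_def)
  then show ?thesis by (auto simp: is_iso_def)
qed

end

section \<open>Tietze transformations preserve the group\<close>

text \<open>This is the case of index one: with a single coset, reading labels is the substitution
  \<open>f\<close>, and \<open>coset_rep\<close> says that \<open>h\<close> undoes
  \<open>f\<close>.\<close>

lemma presented_group_iso:
  fixes X :: "'a set" and Y :: "'b set"
  assumes rels: "Q \<subseteq> words Y \<times> words Y"
    and f: "\<And>x. x \<in> X \<Longrightarrow> f x \<in> words Y" and h: "\<And>y. y \<in> Y \<Longrightarrow> h y \<in> words X"
    and f_rel: "\<And>u v. (u, v) \<in> R \<Longrightarrow> (subst_word f u, subst_word f v) \<in> pres_rel Y Q"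
    and h_rel: "\<And>u v. (u, v) \<in> Q \<Longrightarrow> (subst_word h u, subst_word h v) \<in> pres_rel X R"
    and hf: "\<And>x. x \<in> X \<Longrightarrow> (subst_word h (f x), [Pos x]) \<in> pres_rel X R"
    and fh: "\<And>y. y \<in> Y \<Longrightarrow> (subst_word f (h y), [Pos y]) \<in> pres_rel Y Q"
  shows "presented_group (Y, Q) \<cong> presented_group (X, R)"
proof -
  have lab: "label_word (\<lambda>_ _. ()) (\<lambda>_. subst_letter f) c w = subst_word f w" for c w
    by (induction w arbitrary: c) auto
  have closed: "subst_letter f l \<in> words Y" if "l \<in> letters X" for l
    using that f by (auto simp: letters_def)
  have hf_letter: "([l], subst_word h (subst_letter f l)) \<in> pres_rel X R" if "l \<in> letters X" for l
  proof (cases l)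
    case (Pos x)
    then show ?thesis using hf[of x] that by (auto intro: pres_rel.sym)
  next
    case (Neg x)
    have "subst_word h (inv_word w) = inv_word (subst_word h w)" for w
      by (induction w) (auto simp: subst_letter_inv_letter)
    with Neg show ?thesis using pres_rel_inv_word[OF hf[of x]] that by (auto intro: pres_rel.sym)
  qed
  interpret reidemeister_schreier X R Y Q UNIV "()" "\<lambda>_ _. ()" "\<lambda>_. subst_letter f" "\<lambda>_. []" h
    by unfold_locales
      (use rels h f_rel h_rel fh closed hf_letter in
        \<open>auto simp: lab subst_letter_inv_letter pres_rel_inv_right\<close>)
  have "(\<lambda>w. pres_rel X R `` {w}) ` {w \<in> words X. foldl (\<lambda>_ _. ()) () w = ()}
      = carrier (presented_group (X, R))"
    by (simp add: carrier_presented_group)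
  with iso_stabilizer show ?thesis by simp
qed

lemma tietze_move_iso:
  assumes "tietze_move P Q"
  shows "presented_group P \<cong> presented_group Q"
  using assms
proof cases
  case (add_relation R X u v)
  have "pres_rel X (insert (u, v) R) = pres_rel X R"
  proof (intro subset_antisym subrelI)
    show "(a, b) \<in> pres_rel X R" if "(a, b) \<in> pres_rel X (insert (u, v) R)" for a b
      using _ _ that by (rule pres_rel_subset) (use add_relation(4) in \<open>auto intro: pres_rel.relation\<close>)
    show "(a, b) \<in> pres_rel X (insert (u, v) R)" if "(a, b) \<in> pres_rel X R" for a b
      using _ _ that by (rule pres_rel_subset) (auto intro: pres_rel.relation)
  qed
  with add_relation show ?thesis by (simp add: presented_group_def)
next
  case (add_generator R X y w)
  \<comment> \<open>The new generator is eliminated by its definition; in the other direction the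
    old generators are kept as they are.\<close>
  define f where "f = (\<lambda>x. if x = y then w else [Pos x])"
  let ?R = "insert ([Pos y], w) R"
  have f_id: "subst_word f u = u" if "u \<in> words X" for u
  proof -
    have "subst_word f u = subst_word (\<lambda>x. [Pos x]) u"
      by (rule subst_word_cong[OF that]) (use add_generator(4) in \<open>auto simp: f_def\<close>)
    then show ?thesis by (simp add: subst_word_Pos)
  qed
  have R: "u \<in> words X" "v \<in> words X" if "(u, v) \<in> R" for u v
    using that add_generator(3) by auto
  have mono: "u \<in> words X \<Longrightarrow> u \<in> words (insert y X)" for u
    by (rule words_mono[of X]) auto
  have y: "([Pos y], w) \<in> pres_rel (insert y X) ?R"
    using mono[OF add_generator(5)] by (intro pres_rel.relation) (auto simp: words_Cons)
  have "presented_group (X, R) \<cong> presented_group (insert y X, ?R)"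
  proof (rule presented_group_iso[where f = f and h = "\<lambda>x. [Pos x]"])
    show "(subst_word f u, subst_word f v) \<in> pres_rel X R" if "(u, v) \<in> ?R" for u v
    proof (cases "(u, v) \<in> R")
      case True
      then show ?thesis using R by (simp add: f_id pres_rel.relation)
    next
      case False
      with that have "u = [Pos y]" "v = w" by auto
      moreover have "f y = w" by (simp add: f_def)
      ultimately show ?thesis using add_generator(5) by (simp add: f_id pres_rel.refl)
    qed
    show "(subst_word (\<lambda>x. [Pos x]) u, subst_word (\<lambda>x. [Pos x]) v) \<in> pres_rel (insert y X) ?R"
      if "(u, v) \<in> R" for u v
      using that R mono by (auto simp: subst_word_Pos intro: pres_rel.relation)
    show "(subst_word (\<lambda>x. [Pos x]) (f x), [Pos x]) \<in> pres_rel (insert y X) ?R"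
      if "x \<in> insert y X" for x
      using that pres_rel.sym[OF y]
      by (auto simp: subst_word_Pos f_def words_Cons intro!: pres_rel.refl)
    show "(subst_word f [Pos x], [Pos x]) \<in> pres_rel X R" if "x \<in> X" for x
    proof -
      have x: "[Pos x] \<in> words X" using that by (simp add: words_Cons)
      then show ?thesis unfolding f_id[OF x] by (rule pres_rel.refl)
    qed
    show "R \<subseteq> words X \<times> words X" by (rule add_generator(3))
    show "f x \<in> words X" if "x \<in> insert y X" for x
      using that add_generator(5) by (auto simp: f_def words_Cons)
    show "[Pos x] \<in> words (insert y X)" if "x \<in> X" for x
      using that by (simp add: words_Cons)
  qed
  with add_generator show ?thesis by simp
qed

lemma tietze_equivalent_iso:
  assumes "tietze_equivalent P Q"
  shows "presented_group P \<cong> presented_group Q"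
  using assms unfolding tietze_equivalent_def
proof (induction rule: equivclp_induct)
  case base
  show ?case by (rule iso_refl)
next
  case (step P' Q')
  have "presented_group P' \<cong> presented_group Q'"
    using step.hyps(2)
  proof (rule disjE)
    assume "tietze_move P' Q'"
    then show ?thesis by (rule tietze_move_iso)
  next
    assume "tietze_move Q' P'"
    then show ?thesis by (rule group.iso_sym[OF group_presented_group tietze_move_iso])
  qed
  with step.IH show ?case by (rule iso_trans)
qed

lemma tietze_equivalent_sym: "tietze_equivalent P Q \<Longrightarrow> tietze_equivalent Q P"
  by (simp add: tietze_equivalent_def equivclp_sym)

lemma tietze_equivalent_trans:
  "tietze_equivalent P Q \<Longrightarrow> tietze_equivalent Q S \<Longrightarrow> tietze_equivalent P S"
  unfolding tietze_equivalent_def by (rule equivclp_trans)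

lemma pres_rel_subset_words: "pres_rel X R \<subseteq> words X \<times> words X"
  using pres_rel_words by fast

lemma tietze_add_relations:
  assumes "finite S" "R \<subseteq> words X \<times> words X" "S \<subseteq> pres_rel X R"
  shows "tietze_equivalent (X, R) (X, R \<union> S)"
  using assms
proof (induction rule: finite_induct)
  case empty
  then show ?case by (simp add: tietze_equivalent_def)
next
  case (insert r S)
  obtain u v where r: "r = (u, v)" by (cases r)
  have "S \<subseteq> words X \<times> words X"
    using insert.prems(2) pres_rel_subset_words by blast
  moreover have "(u, v) \<in> pres_rel X (R \<union> S)"
  proof (rule pres_rel_subset)
    show "(u, v) \<in> pres_rel X R" using insert.prems(2) r by simp
  qed (auto intro: pres_rel.relation)
  ultimately have "tietze_move (X, R \<union> S) (X, insert (u, v) (R \<union> S))"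
    using insert.prems(1) by (intro tietze_move.add_relation) auto
  then have "tietze_equivalent (X, R \<union> S) (X, R \<union> insert r S)"
    by (simp add: tietze_equivalent_def r r_into_equivclp)
  moreover have "tietze_equivalent (X, R) (X, R \<union> S)" using insert by simp
  ultimately show ?case by (rule tietze_equivalent_trans[rotated])
qed

text \<open>The union \<open>R \<union> S\<close> is reached from either side by adding
  consequences.\<close>

lemma tietze_replace_relations:
  assumes "finite R" "R \<subseteq> pres_rel X S" "finite S" "S \<subseteq> pres_rel X R"
  shows "tietze_equivalent (X, R) (X, S)"
proof -
  have words: "R \<subseteq> words X \<times> words X" "S \<subseteq> words X \<times> words X"
    using assms pres_rel_subset_words by blast+
  from tietze_add_relations[OF assms(1) words(2) assms(2)]
  have "tietze_equivalent (X, R \<union> S) (X, S)"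
    by (simp add: Un_commute tietze_equivalent_sym)
  with tietze_add_relations[OF assms(3) words(1) assms(4)] show ?thesis
    by (rule tietze_equivalent_trans)
qed

text \<open>All definitions are words in the original \<open>X\<close>, so each can be added without
  regard to the others.\<close>

lemma tietze_add_generators:
  assumes "distinct (map fst ds)" "R \<subseteq> words X \<times> words X"
    "\<And>y w. (y, w) \<in> set ds \<Longrightarrow> y \<notin> X \<and> w \<in> words X"
  shows "tietze_equivalent (X, R) (X \<union> fst ` set ds, R \<union> (\<lambda>(y, w). ([Pos y], w)) ` set ds)"
  using assms
proof (induction ds)
  case Nil
  then show ?case by (simp add: tietze_equivalent_def)
next
  case (Cons d ds)
  obtain y w where d: "d = (y, w)" by (cases d)
  let ?X = "X \<union> fst ` set ds" and ?R = "R \<union> (\<lambda>(y, w). ([Pos y], w)) ` set ds"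
  have mono: "u \<in> words X \<Longrightarrow> u \<in> words ?X" for u by (rule words_mono[of X]) auto
  have "?R \<subseteq> words ?X \<times> words ?X"
  proof (rule subrelI)
    fix u v assume "(u, v) \<in> ?R"
    then consider "(u, v) \<in> R" | y where "(y, v) \<in> set ds" "u = [Pos y]" by auto
    then show "(u, v) \<in> words ?X \<times> words ?X"
    proof cases
      case 1
      then show ?thesis using Cons.prems(2) mono by blast
    next
      case 2
      then have "v \<in> words X" using Cons.prems(3)[of y v] by simp
      moreover have "y \<in> ?X" using 2(1) by force
      ultimately show ?thesis using 2(2) mono by (simp add: words_Cons)
    qed
  qed
  moreover have "y \<notin> ?X" "w \<in> words ?X"
    using Cons.prems(1) Cons.prems(3)[of y w] mono by (auto simp: d)
  ultimately have "tietze_move (?X, ?R) (insert y ?X, insert ([Pos y], w) ?R)"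
    by (rule tietze_move.add_generator)
  then have "tietze_equivalent (?X, ?R) (insert y ?X, insert ([Pos y], w) ?R)"
    by (simp add: tietze_equivalent_def r_into_equivclp)
  moreover have "tietze_equivalent (X, R) (?X, ?R)"
  proof (rule Cons.IH)
    show "z \<notin> X \<and> v \<in> words X" if "(z, v) \<in> set ds" for z v
      using that Cons.prems(3)[of z v] by simp
  qed (use Cons.prems(1,2) in simp_all)
  ultimately have "tietze_equivalent (X, R) (insert y ?X, insert ([Pos y], w) ?R)"
    by (rule tietze_equivalent_trans[rotated])
  then show ?case by (simp add: d)
qed


section \<open>Free reduction and conjugates of a relator\<close>

text \<open>Folding from the right keeps the tail reduced, so a new letter can only cancel against
  the head of the tail.\<close>

definition free_reduce :: "'a gword \<Rightarrow> 'a gword" where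
  "free_reduce w = foldr (\<lambda>l v. case v of [] \<Rightarrow> [l]
     | m # u \<Rightarrow> if m = inv_letter l then u else l # v) w []"

lemma pres_rel_free_reduce: "w \<in> words X \<Longrightarrow> (w, free_reduce w) \<in> pres_rel X R"
proof (induction w)
  case Nil
  then show ?case by (simp add: free_reduce_def pres_rel.refl)
next
  case (Cons l w)
  then have l: "l \<in> letters X" "[l] \<in> words X" and IH: "(w, free_reduce w) \<in> pres_rel X R"
    by (auto simp: words_Cons)
  from pres_rel.append[OF pres_rel.refl[OF l(2)] IH]
  have step: "(l # w, l # free_reduce w) \<in> pres_rel X R" by simp
  show ?case
  proof (cases "\<exists>u. free_reduce w = inv_letter l # u")
    case True
    then obtain u where u: "free_reduce w = inv_letter l # u" by blast
    then have "u \<in> words X" using pres_rel_words[OF IH] by (simp add: words_Cons)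
    from pres_rel.append[OF pres_rel.cancel[OF l(1)] pres_rel.refl[OF this]]
    have "(l # free_reduce w, u) \<in> pres_rel X R" by (simp add: u)
    with step have "(l # w, u) \<in> pres_rel X R" by (rule pres_rel.trans)
    moreover have "free_reduce (l # w) = u" using u by (simp add: free_reduce_def)
    ultimately show ?thesis by simp
  next
    case False
    then have "free_reduce (l # w) = l # free_reduce w"
      by (auto simp: free_reduce_def split: list.split)
    with step show ?thesis by simp
  qed
qed

definition relator_conjugates :: "'a gword \<Rightarrow> 'a gword list" where
  "relator_conjugates r =
     map (\<lambda>i. rotate i r) [0..<length r] @ map (\<lambda>i. rotate i (inv_word r)) [0..<length r]"

text \<open>A sufficient test only: a product of several relators, or a conjugate that is not
  already a rotation after free reduction, may be rejected.\<close>

definition conjugate_or_trivial :: "'a gword \<Rightarrow> 'a gword \<Rightarrow> bool" where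
  "conjugate_or_trivial r w =
     (case free_reduce w of [] \<Rightarrow> True | l # v \<Rightarrow> List.member (relator_conjugates r) (l # v))"

lemma conjugate_or_trivialD:
  assumes r: "(r, []) \<in> pres_rel X R" and w: "w \<in> words X" "conjugate_or_trivial r w"
  shows "(w, []) \<in> pres_rel X R"
proof -
  have "(inv_word r, []) \<in> pres_rel X R" using pres_rel_inv_word[OF r] by simp
  then have "(v, []) \<in> pres_rel X R" if "v \<in> set (relator_conjugates r)" for v
    using that r by (auto simp: relator_conjugates_def intro: pres_rel_rotate)
  then have "(free_reduce w, []) \<in> pres_rel X R"
    using w(2) by (auto simp: conjugate_or_trivial_def pres_rel.refl split: list.splits)
  with pres_rel_free_reduce[OF w(1)] show ?thesis by (rule pres_rel.trans)
qed

lemma pres_rel_subst_definitions: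
  assumes "\<And>y. y \<in> X \<Longrightarrow> ([Pos y], f y) \<in> pres_rel X R"
  shows "w \<in> words X \<Longrightarrow> (w, subst_word f w) \<in> pres_rel X R"
proof (induction w)
  case Nil
  then show ?case by (simp add: pres_rel.refl)
next
  case (Cons l w)
  then have l: "l \<in> letters X" and IH: "(w, subst_word f w) \<in> pres_rel X R"
    by (auto simp: words_Cons)
  have "([l], subst_letter f l) \<in> pres_rel X R"
  proof (cases l)
    case (Pos y)
    then show ?thesis using assms l by simp
  next
    case (Neg y)
    then show ?thesis using pres_rel_inv_word[OF assms[of y]] l by simp
  qed
  from pres_rel.append[OF this IH] show ?case by simp
qed

section \<open>Rewriting in the cactus group\<close>

primrec letter_gen :: "'a letter \<Rightarrow> 'a" where
  "letter_gen (Pos x) = x"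
| "letter_gen (Neg x) = x"

lemma cactus_square:
  assumes "x \<in> cactus_gens n"
  shows "([Pos x, Pos x], []) \<in> pres_rel (cactus_gens n) (cactus_rels n)"
  using assms by (intro pres_rel.relation; cases x) (auto simp: cactus_rels_def words_Cons)

lemma cactus_commute:
  assumes "(p, q) \<in> cactus_gens n" "(m, r) \<in> cactus_gens n" "q < m \<or> r < p"
  shows "([s p q, s m r], [s m r, s p q]) \<in> pres_rel (cactus_gens n) (cactus_rels n)"
proof -
  have "{p..q} \<inter> {m..r} = {}" using assms(3) by auto
  then show ?thesis
    using assms by (intro pres_rel.relation) (auto simp: cactus_rels_def words_Cons)
qed

lemma cactus_nested:
  assumes "(p, q) \<in> cactus_gens n" "(m, r) \<in> cactus_gens n" "p \<le> m" "r \<le> q"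
  shows "([s p q, s m r], [s (p + q - r) (p + q - m), s p q])
    \<in> pres_rel (cactus_gens n) (cactus_rels n)"
proof -
  have "{m..r} \<subseteq> {p..q}" using assms(3,4) by auto
  moreover have "(p + q - r, p + q - m) \<in> cactus_gens n"
    using assms by (auto simp: cactus_gens_def)
  ultimately show ?thesis
    using assms(1,2) by (intro pres_rel.relation) (auto simp: cactus_rels_def words_Cons)
qed

text \<open>The generators with long intervals are moved to the right, past the intervals inside them.\<close>

primrec cactus_insert :: "nat \<times> nat \<Rightarrow> (nat \<times> nat) list \<Rightarrow> (nat \<times> nat) list" where
  "cactus_insert x [] = [x]"
| "cactus_insert x (y # w) =
    (if x = y then w
     else if fst x \<le> fst y \<and> snd y \<le> snd x
       then (fst x + snd x - snd y, fst x + snd x - fst y) # cactus_insert x w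
     else if snd y < fst x then y # cactus_insert x w
     else x # y # w)"

definition cactus_reduce :: "(nat \<times> nat) list \<Rightarrow> (nat \<times> nat) list" where
  "cactus_reduce w = foldr cactus_insert w []"

lemma cactus_word_words: "map Pos w \<in> words (cactus_gens n) \<longleftrightarrow> set w \<subseteq> cactus_gens n"
  by (induction w) (auto simp: words_Cons)

lemma pres_rel_cactus_insert:
  "x \<in> cactus_gens n \<Longrightarrow> set w \<subseteq> cactus_gens n \<Longrightarrow>
    (map Pos (x # w), map Pos (cactus_insert x w)) \<in> pres_rel (cactus_gens n) (cactus_rels n)"
proof (induction w)
  case Nil
  then show ?case by (simp add: pres_rel.refl words_Cons)
next
  case (Cons y w)
  let ?P = "pres_rel (cactus_gens n) (cactus_rels n)"
  have w: "map Pos w \<in> words (cactus_gens n)" and y: "y \<in> cactus_gens n"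
    and IH: "(map Pos (x # w), map Pos (cactus_insert x w)) \<in> ?P"
    using Cons by (simp_all add: cactus_word_words)
  have swap: "(map Pos (x # y # w), map Pos (z # cactus_insert x w)) \<in> ?P"
    if "([Pos x, Pos y], [Pos z, Pos x]) \<in> ?P" for z
  proof -
    have z: "[Pos z] \<in> words (cactus_gens n)"
      using pres_rel_words[OF that] by (simp add: words_Cons)
    from pres_rel.append[OF that pres_rel.refl[OF w]]
    have "(map Pos (x # y # w), map Pos (z # x # w)) \<in> ?P" by simp
    moreover from pres_rel.append[OF pres_rel.refl[OF z] IH]
    have "(map Pos (z # x # w), map Pos (z # cactus_insert x w)) \<in> ?P" by simp
    ultimately show ?thesis by (rule pres_rel.trans)
  qed
  obtain p q m r where pq: "x = (p, q)" "y = (m, r)" by (cases x, cases y)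
  consider "x = y" | "x \<noteq> y" "p \<le> m" "r \<le> q" | "\<not> (p \<le> m \<and> r \<le> q)" "r < p"
    | "x \<noteq> y" "\<not> (p \<le> m \<and> r \<le> q)" "\<not> r < p"
    by blast
  then show ?case
  proof cases
    case 1
    from pres_rel.append[OF cactus_square[OF Cons.prems(1)] pres_rel.refl[OF w]] 1
    show ?thesis by simp
  next
    case 2
    with swap[OF cactus_nested[of p q n m r, folded pq]] Cons.prems(1) y pq show ?thesis by auto
  next
    \<comment> \<open>Disjoint intervals are exchanged only when the left one stands second, which
      sorts them from left to right.\<close>
    case 3
    with swap[OF cactus_commute[of p q n m r, folded pq]] Cons.prems(1) y pq show ?thesis by auto
  next
    case 4
    have "map Pos (x # y # w) \<in> words (cactus_gens n)"
      using w y Cons.prems(1) by (simp add: words_Cons)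
    with 4 pq show ?thesis by (auto simp: pres_rel.refl)
  qed
qed

lemma pres_rel_cactus_reduce:
  "set w \<subseteq> cactus_gens n \<Longrightarrow>
    (map Pos w, map Pos (cactus_reduce w)) \<in> pres_rel (cactus_gens n) (cactus_rels n)"
proof (induction w)
  case Nil
  then show ?case by (simp add: cactus_reduce_def pres_rel.refl)
next
  case (Cons x w)
  let ?P = "pres_rel (cactus_gens n) (cactus_rels n)"
  from Cons have x: "x \<in> cactus_gens n" "[Pos x] \<in> words (cactus_gens n)"
    and IH: "(map Pos w, map Pos (cactus_reduce w)) \<in> ?P"
    by (simp_all add: words_Cons)
  from pres_rel.append[OF pres_rel.refl[OF x(2)] IH]
  have "(map Pos (x # w), map Pos (x # cactus_reduce w)) \<in> ?P" by simp
  moreover have "(map Pos (x # cactus_reduce w), map Pos (cactus_insert x (cactus_reduce w))) \<in> ?P"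
    using pres_rel_words[OF IH] by (intro pres_rel_cactus_insert x) (simp add: cactus_word_words)
  ultimately have "(map Pos (x # w), map Pos (cactus_insert x (cactus_reduce w))) \<in> ?P"
    by (rule pres_rel.trans)
  then show ?case by (simp add: cactus_reduce_def)
qed

lemma pres_rel_letter_gen:
  "w \<in> words (cactus_gens n) \<Longrightarrow>
    (w, map Pos (map letter_gen w)) \<in> pres_rel (cactus_gens n) (cactus_rels n)"
proof (induction w)
  case Nil
  then show ?case by (simp add: pres_rel.refl)
next
  case (Cons l w)
  let ?P = "pres_rel (cactus_gens n) (cactus_rels n)"
  from Cons have l: "l \<in> letters (cactus_gens n)"
    and IH: "(w, map Pos (map letter_gen w)) \<in> ?P"
    by (simp_all add: words_Cons)
  have "([l], [Pos (letter_gen l)]) \<in> ?P"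
  proof (cases l)
    case (Pos x)
    with l show ?thesis by (simp add: pres_rel.refl words_Cons)
  next
    case (Neg x)
    with l have "([Pos x] @ [Pos x], []) \<in> ?P" by (simp add: cactus_square)
    from pres_rel.sym[OF pres_rel_split_right[OF this]] Neg show ?thesis by simp
  qed
  from pres_rel.append[OF this IH] show ?case by simp
qed

text \<open>The rewriting is not confluent, and two passes are what the words below need.\<close>

definition cactus_trivial :: "(nat \<times> nat) gword \<Rightarrow> bool" where
  "cactus_trivial w = (cactus_reduce (cactus_reduce (map letter_gen w)) = [])"

lemma cactus_trivialD:
  assumes w: "w \<in> words (cactus_gens n)" and triv: "cactus_trivial w"
  shows "(w, []) \<in> pres_rel (cactus_gens n) (cactus_rels n)"
proof -
  note 1 = pres_rel_letter_gen[OF w]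
  from pres_rel_words[OF 1] have "set (map letter_gen w) \<subseteq> cactus_gens n"
    by (simp only: cactus_word_words)
  note 2 = pres_rel_cactus_reduce[OF this]
  from pres_rel_words[OF 2] have "set (cactus_reduce (map letter_gen w)) \<subseteq> cactus_gens n"
    by (simp only: cactus_word_words)
  note 3 = pres_rel_cactus_reduce[OF this]
  from pres_rel.trans[OF pres_rel.trans[OF 1 2] 3] triv show ?thesis
    by (simp add: cactus_trivial_def)
qed


section \<open>The presentation with one relator\<close>

abbreviation relator :: "nat gword" where
  "relator \<equiv> [g 2, g 9, g_inv 10, g_inv 8, g 4, g 9, g 2, g 10, g_inv 8, g_inv 4]"

abbreviation one_gens :: "nat set" where
  "one_gens \<equiv> {2, 4, 8, 9, 10}"

abbreviation one_rels :: "(nat gword \<times> nat gword) set" where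
  "one_rels \<equiv> {(relator, [])}"

lemma relator_words: "relator \<in> words one_gens"
  by (simp add: words_Cons)

lemma relator_pres_rel: "(relator, []) \<in> pres_rel one_gens one_rels"
  by (intro pres_rel.relation relator_words) auto


section \<open>The cosets of the pure cactus group\<close>

definition gen_list :: "(nat \<times> nat) list" where
  "gen_list = [(1, 2), (2, 3), (3, 4), (1, 3), (2, 4), (1, 4)]"

lemma cactus_gens_4: "cactus_gens 4 = set gen_list"
proof -
  have "p \<in> {1, 2, 3} \<and> q \<in> {2, 3, 4}" if "1 \<le> p" "p < q" "q \<le> 4" for p q :: nat
    using that by auto
  then have "(p, q) \<in> cactus_gens 4 \<longleftrightarrow> (p, q) \<in> set gen_list" for p q
    by (auto simp: cactus_gens_def gen_list_def)
  then show ?thesis by auto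
qed

text \<open>A coset of the kernel is represented by the list of the values of its permutation.\<close>

definition cosets :: "nat list list" where
  "cosets = filter distinct (List.n_lists 4 [1, 2, 3, 4])"

text \<open>Membership in \<open>cosets\<close>, tested without a comparison with all 24
  lists.\<close>

definition is_coset :: "nat list \<Rightarrow> bool" where
  "is_coset c \<longleftrightarrow> length c = 4 \<and> set c \<subseteq> {1, 2, 3, 4} \<and> distinct c"

lemma set_cosets: "c \<in> set cosets \<longleftrightarrow> is_coset c"
  by (auto simp: cosets_def is_coset_def set_n_lists)

text \<open>Right multiplication of a permutation by a reversal: the entries at the positions p to q
  change their order. List positions start at 0, hence the \<open>- 1\<close>.\<close>

definition coset_act :: "nat list \<Rightarrow> (nat \<times> nat) letter \<Rightarrow> nat list" where
  "coset_act c l = (case letter_gen l of (p, q) \<Rightarrow>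
     map (\<lambda>i. c ! (reversal p q i - 1)) [1, 2, 3, 4])"

text \<open>The twelve pairs of cosets that differ by \<open>s 1 4\<close> are the pentagons of a tiling of a closed
  surface with fundamental group \<open>PJ\<^sub>4\<close>, and the other five generators are the edges of a pentagon.
  The words come from a spanning tree of the dual graph, whose edges have trivial labels, and from
  gluing the pentagons along further edges to a single ten-gon; only the
  nontrivial labels are listed, in one of the two directions.\<close>

definition edge_words :: "((nat list \<times> nat \<times> nat) \<times> nat gword) list" where
  "edge_words = [
    (([1, 4, 3, 2], 1, 2), [g 2]),
    (([1, 2, 4, 3], 2, 4), [g 4]),
    (([1, 4, 3, 2], 1, 3), [g 4]),
    (([1, 4, 3, 2], 2, 3), [g 4]),
    (([1, 2, 4, 3], 1, 3), [g 8]),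
    (([2, 1, 4, 3], 1, 3), [g 8]),
    (([1, 3, 4, 2], 3, 4), [g 9]),
    (([2, 3, 1, 4], 1, 2), [g 10]),
    (([2, 3, 1, 4], 1, 3), [g 10]),
    (([3, 1, 2, 4], 1, 2), [g 10]),
    (([1, 4, 2, 3], 1, 2), [g 2, g 10]),
    (([2, 1, 4, 3], 2, 3), [g_inv 4, g 2]),
    (([1, 2, 4, 3], 2, 3), [g 4, g 9]),
    (([2, 4, 1, 3], 1, 2), [g 9, g_inv 10]),
    (([2, 4, 1, 3], 1, 3), [g 9, g_inv 10, g_inv 8, g 4, g 9])]"

text \<open>Paths in the spanning tree, one for each pentagon, which is named by its coset with
  \<open>hd c < last c\<close>. The final \<open>s 1 4\<close> of the last path only switches to
  that coset within the same pentagon.\<close>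

definition tree_words :: "(nat list \<times> (nat \<times> nat) gword) list" where
  "tree_words = [
    ([1, 2, 3, 4], []),
    ([2, 1, 3, 4], [s 1 2]),
    ([3, 2, 1, 4], [s 1 3]),
    ([1, 3, 2, 4], [s 2 3]),
    ([1, 4, 3, 2], [s 2 4]),
    ([1, 2, 4, 3], [s 3 4]),
    ([3, 1, 2, 4], [s 1 2, s 1 3]),
    ([2, 3, 1, 4], [s 1 2, s 2 3]),
    ([2, 1, 4, 3], [s 1 2, s 3 4]),
    ([1, 4, 2, 3], [s 2 3, s 2 4]),
    ([2, 4, 1, 3], [s 1 2, s 2 3, s 2 4]),
    ([1, 3, 4, 2], [s 1 2, s 2 4, s 1 4])]"

text \<open>Each path climbs the tree, crosses one edge whose label is the single generator in
  question, and descends along the tree. Where the descent ends in \<open>[4, 3, 2, 1]\<close>, a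
  final \<open>s 1 4\<close> leads back to \<open>[1, 2, 3, 4]\<close>.\<close>

definition loop_words :: "(nat \<times> (nat \<times> nat) gword) list" where
  "loop_words = [
    (2, [s 2 4, s 1 2, s 2 3, s 3 4, s 1 4]),
    (4, [s 3 4, s 2 4, s 1 3, s 3 4, s 1 4]),
    (8, [s 1 2, s 3 4, s 1 3, s 2 4, s 1 4]),
    (9, [s 1 2, s 2 4, s 1 2, s 2 3, s 1 4]),
    (10, [s 1 2, s 2 3, s 1 2, s 1 3])]"

text \<open>The coset \<open>rev c\<close> is reached from \<open>c\<close> by \<open>s 1 4\<close>,
  and moving \<open>s p q\<close> past \<open>s 1 4\<close> turns it into
  \<open>s (5 - q) (5 - p)\<close>. The two cosets therefore share their edges up to this
  mirroring.\<close>

definition pentagon_edge :: "nat list \<Rightarrow> nat \<times> nat \<Rightarrow> nat list \<times> nat \<times> nat" where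
  "pentagon_edge c x = (if hd c < last c then (c, x) else (rev c, 5 - snd x, 5 - fst x))"

text \<open>Edges listed in neither direction have the trivial label; among them are the tree edges
  and the step \<open>s 1 4\<close> inside a pentagon.\<close>

definition coset_label :: "nat list \<Rightarrow> (nat \<times> nat) letter \<Rightarrow> nat gword" where
  "coset_label c l = (case map_of edge_words (pentagon_edge c (letter_gen l)) of
     Some w \<Rightarrow> w
   | None \<Rightarrow>
      (case map_of edge_words (pentagon_edge (coset_act c l) (letter_gen l)) of
         Some w \<Rightarrow> inv_word w
       | None \<Rightarrow> []))"

definition coset_word :: "nat list \<Rightarrow> (nat \<times> nat) gword" where
  "coset_word c = (if hd c < last c then the (map_of tree_words c)
     else the (map_of tree_words (rev c)) @ [s 1 4])"

definition loop_word :: "nat \<Rightarrow> (nat \<times> nat) gword" where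
  "loop_word y = the (map_of loop_words y)"

lemma coset_act_Neg: "coset_act c (Neg x) = coset_act c (Pos x)"
  by (simp add: coset_act_def)

lemma coset_label_Neg: "coset_label c (Neg x) = coset_label c (Pos x)"
  by (simp add: coset_label_def coset_act_Neg cong: option.case_cong)

section \<open>Finite checks on the tables\<close>

definition check_label :: "nat list \<Rightarrow> nat \<times> nat \<Rightarrow> bool" where
  "check_label c x \<longleftrightarrow> is_coset (coset_act c (Pos x))
     \<and> set (map letter_gen (coset_label c (Pos x))) \<subseteq> one_gens"

definition check_closed :: "nat list \<Rightarrow> bool" where
  "check_closed c \<longleftrightarrow> set (map letter_gen (coset_word c)) \<subseteq> set gen_list
     \<and> list_all (check_label c) gen_list"

definition check_relation :: "nat list \<Rightarrow> (nat \<times> nat) gword \<Rightarrow> (nat \<times> nat) gword \<Rightarrow> bool" where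
  "check_relation c u v \<longleftrightarrow> foldl coset_act c u = foldl coset_act c v
    \<and> conjugate_or_trivial relator (label_word coset_act coset_label c u
        @ inv_word (label_word coset_act coset_label c v))"

text \<open>The checks are stated with partial applications of constants because the simplifier would
  unfold them symbolically below an abstraction.\<close>

definition check_pair :: "nat list \<Rightarrow> nat \<times> nat \<Rightarrow> nat \<times> nat \<Rightarrow> bool" where
  "check_pair c x y =
     (if x = y then check_relation c [Pos x, Pos x] []
      else if snd x < fst y \<or> snd y < fst x
        then check_relation c [Pos x, Pos y] [Pos y, Pos x]
      else if fst x \<le> fst y \<and> snd y \<le> snd x
        then check_relation c [Pos x, Pos y]
          [Pos (fst x + snd x - snd y, fst x + snd x - fst y), Pos x]
      else True)"

definition check_row :: "nat list \<Rightarrow> nat \<times> nat \<Rightarrow> bool" where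
  "check_row c x = list_all (check_pair c x) gen_list"

definition check_relations :: "nat list \<Rightarrow> bool" where
  "check_relations c = list_all (check_row c) gen_list"

text \<open>The identity \<open>coset_rep\<close> of the locale, written as one word to be reduced
  in the cactus group.\<close>

definition check_coset_word :: "nat list \<Rightarrow> nat \<times> nat \<Rightarrow> bool" where
  "check_coset_word c x = cactus_trivial ((coset_word c @ [Pos x])
     @ inv_word (subst_word loop_word (coset_label c (Pos x)) @ coset_word (coset_act c (Pos x))))"

definition check_coset_words :: "nat list \<Rightarrow> bool" where
  "check_coset_words c = list_all (check_coset_word c) gen_list"

lemma check_loop_relator: "cactus_trivial (subst_word loop_word relator)"
  by code_simp

text \<open>Free reduction suffices here, because each loop crosses only one edge with a nontrivial
  label.\<close>

lemma check_loops: "list_all (\<lambda>y. set (map letter_gen (loop_word y)) \<subseteq> set gen_list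
    \<and> foldl coset_act [1, 2, 3, 4] (loop_word y) = [1, 2, 3, 4]
    \<and> free_reduce (label_word coset_act coset_label [1, 2, 3, 4] (loop_word y)) = [Pos y])
  [2, 4, 8, 9, 10]"
  by code_simp

lemma check_closed: "list_all check_closed cosets"
  by code_simp

lemma check_coset_words: "list_all check_coset_words cosets"
  by code_simp

lemma check_relations: "list_all check_relations cosets"
  by code_simp

section \<open>The pure cactus group of degree four\<close>

lemma words_letter_gen: "w \<in> words X \<longleftrightarrow> set (map letter_gen w) \<subseteq> X"
proof (induction w)
  case (Cons l w)
  then show ?case by (cases l) (auto simp: words_Cons)
qed simp

section \<open>The coset action and the homomorphism to the symmetric group\<close>

lemma coset_act_map:
  assumes "x \<in> cactus_gens 4"
  shows "coset_act (map f [1, 2, 3, 4]) (Pos x)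
    = map (f \<circ> (case x of (p, q) \<Rightarrow> reversal p q)) [1, 2, 3, 4]"
proof -
  obtain p q where x: "x = (p, q)" by (cases x)
  have nth: "map f [1, 2, 3, 4] ! (j - 1) = f j" if "j \<in> {1..4}" for j :: nat
  proof -
    have "j = 1 \<or> j = 2 \<or> j = 3 \<or> j = 4" using that by auto
    then show ?thesis by auto
  qed
  have "reversal p q i \<in> {1..4}" if "i \<in> {1..4}" for i
    using permutes_in_image[OF reversal_permutes[of p q 4]] assms x that by simp
  then show ?thesis
    unfolding coset_act_def x letter_gen.simps prod.case o_def
    by (intro map_cong[OF HOL.refl] nth) auto
qed

lemma eval_letter_sym_group:
  assumes "l \<in> letters (cactus_gens n)"
  shows "eval_letter (sym_group n) (\<lambda>(p, q). reversal p q) l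
    = (case letter_gen l of (p, q) \<Rightarrow> reversal p q)"
proof (cases l)
  case (Neg x)
  obtain p q where x: "x = (p, q)" by (cases x)
  have "reversal p q \<circ> reversal p q = id"
    by (auto simp: reversal_def fun_eq_iff)
  moreover have "reversal p q \<in> carrier (sym_group n)"
    using assms reversal_permutes Neg x by (auto simp: sym_group_carrier)
  ultimately have "inv\<^bsub>sym_group n\<^esub> (reversal p q) = reversal p q"
    by (intro group.inv_equality[OF sym_group_is_group]) (simp_all add: sym_group_mult sym_group_one)
  with Neg x show ?thesis by simp
qed simp

text \<open>The map \<open>f\<close> is arbitrary because the permutation of the prefix already read
  accumulates in it.\<close>

lemma run_coset_act:
  "w \<in> words (cactus_gens 4) \<Longrightarrow> foldl coset_act (map f [1, 2, 3, 4]) w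
    = map (f \<circ> eval_word (sym_group 4) (\<lambda>(p, q). reversal p q) w) [1, 2, 3, 4]"
proof (induction w arbitrary: f)
  case Nil
  show ?case by (simp add: eval_word_def sym_group_one)
next
  case (Cons l w)
  let ?r = "case letter_gen l of (p, q) \<Rightarrow> reversal p q"
  have l: "l \<in> letters (cactus_gens 4)" and w: "w \<in> words (cactus_gens 4)"
    using Cons.prems by (simp_all add: words_Cons)
  have "coset_act c l = coset_act c (Pos (letter_gen l))" for c
    by (simp add: coset_act_def)
  moreover have "letter_gen l \<in> cactus_gens 4" using l by (cases l) simp_all
  ultimately have "foldl coset_act (map f [1, 2, 3, 4]) (l # w)
      = foldl coset_act (map (f \<circ> ?r) [1, 2, 3, 4]) w"
    by (simp only: foldl_Cons coset_act_map)
  also have "\<dots> = map ((f \<circ> ?r) \<circ> eval_word (sym_group 4) (\<lambda>(p, q). reversal p q) w) [1, 2, 3, 4]"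
    by (rule Cons.IH[OF w])
  also have "(f \<circ> ?r) \<circ> eval_word (sym_group 4) (\<lambda>(p, q). reversal p q) w
      = f \<circ> eval_word (sym_group 4) (\<lambda>(p, q). reversal p q) (l # w)"
    by (simp add: eval_word_def eval_letter_sym_group[OF l] sym_group_mult o_assoc)
  finally show ?case .
qed

text \<open>The permutation fixes everything outside \<open>{1..4}\<close>, so its four values
  decide whether it is the identity.\<close>

lemma cactus_perm_id_iff:
  assumes w: "w \<in> words (cactus_gens 4)"
  shows "cactus_perm 4 (pres_rel (cactus_gens 4) (cactus_rels 4) `` {w}) = id
    \<longleftrightarrow> foldl coset_act [1, 2, 3, 4] w = [1, 2, 3, 4]"
proof -
  let ?e = "eval_word (sym_group 4) (\<lambda>(p, q). reversal p q) w"
  have "?e permutes {1..4}"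
    using group.eval_word_closed[OF sym_group_is_group reversal_in_sym_group w]
    by (simp add: sym_group_carrier)
  then have "?e = id \<longleftrightarrow> (\<forall>i \<in> {1..4}. ?e i = i)"
    by (auto simp: fun_eq_iff permutes_def)
  also have "{1..4} = set [1, 2, 3, 4 :: nat]" by auto
  also have "(\<forall>i \<in> set [1, 2, 3, 4]. ?e i = i) \<longleftrightarrow> map ?e [1, 2, 3, 4] = [1, 2, 3, 4]" by simp
  also have "map ?e [1, 2, 3, 4] = foldl coset_act [1, 2, 3, 4] w"
    using run_coset_act[OF w, of id] by simp
  also have "?e = cactus_perm 4 (pres_rel (cactus_gens 4) (cactus_rels 4) `` {w})"
    unfolding cactus_perm_def
    by (rule group.induced_map_class[OF sym_group_is_group reversal_in_sym_group
          cactus_rels_in_sym_group w, symmetric])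
  finally show ?thesis .
qed

lemma pure_cactus_group_4:
  "pure_cactus_group 4 = (presented_group (cactus_gens 4, cactus_rels 4))
    \<lparr>carrier := (\<lambda>w. pres_rel (cactus_gens 4) (cactus_rels 4) `` {w})
      ` {w \<in> words (cactus_gens 4). foldl coset_act [1, 2, 3, 4] w = [1, 2, 3, 4]}\<rparr>"
proof -
  have "kernel (cactus_group 4) (sym_group 4) (cactus_perm 4)
    = (\<lambda>w. pres_rel (cactus_gens 4) (cactus_rels 4) `` {w})
      ` {w \<in> words (cactus_gens 4). foldl coset_act [1, 2, 3, 4] w = [1, 2, 3, 4]}"
    using cactus_perm_id_iff
    by (auto simp: kernel_def cactus_group_def carrier_presented_group sym_group_one)
  then show ?thesis by (simp only: pure_cactus_group_def cactus_group_def)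
qed

lemma cactus_rels_words: "cactus_rels n \<subseteq> words (cactus_gens n) \<times> words (cactus_gens n)"
proof -
  have "(p + q - r, p + q - m) \<in> cactus_gens n"
    if "(p, q) \<in> cactus_gens n" "(m, r) \<in> cactus_gens n" "{m..r} \<subseteq> {p..q}" for p q m r
  proof -
    have "p \<le> m" "r \<le> q" using that by (auto simp: cactus_gens_def)
    then show ?thesis using that by (auto simp: cactus_gens_def)
  qed
  then show ?thesis by (auto simp: cactus_rels_def words_Cons)
qed

interpretation PJ: reidemeister_schreier "cactus_gens 4" "cactus_rels 4" one_gens one_rels
  "set cosets" "[1, 2, 3, 4]" coset_act coset_label coset_word loop_word
proof
  let ?P = "pres_rel (cactus_gens 4) (cactus_rels 4)" and ?Q = "pres_rel one_gens one_rels"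
  have gen: "letter_gen l \<in> set gen_list" if "l \<in> letters (cactus_gens 4)" for l
    using that by (cases l) (simp_all add: cactus_gens_4)
  have act_gen: "coset_act c l = coset_act c (Pos (letter_gen l))"
    and label_gen: "coset_label c l = coset_label c (Pos (letter_gen l))" for c l
    by (cases l; simp add: coset_act_Neg coset_label_Neg)+
  show base: "[1, 2, 3, 4] \<in> set cosets" by (simp add: set_cosets is_coset_def)
  show "coset_word [1, 2, 3, 4] = []" by (simp add: coset_word_def tree_words_def)
  show "one_rels \<subseteq> words one_gens \<times> words one_gens" using relator_words by auto
  have closed: "check_closed c" if "c \<in> set cosets" for c
    using check_closed that by (auto simp: list_all_iff)
  then show rep: "coset_word c \<in> words (cactus_gens 4)" if "c \<in> set cosets" for c
    using that by (simp add: check_closed_def words_letter_gen cactus_gens_4)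
  have "check_label c (letter_gen l)" if "c \<in> set cosets" "l \<in> letters (cactus_gens 4)" for c l
    using closed[OF that(1)] gen[OF that(2)] by (simp add: check_closed_def list_all_iff)
  then show act: "coset_act c l \<in> set cosets"
    and lab: "coset_label c l \<in> words one_gens"
    if "c \<in> set cosets" "l \<in> letters (cactus_gens 4)" for c l
    using that unfolding act_gen[of c l] label_gen[of c l]
    by (simp_all add: check_label_def set_cosets words_letter_gen)
  have lab_word: "label_word coset_act coset_label c w \<in> words one_gens"
    if "c \<in> set cosets" "w \<in> words (cactus_gens 4)" for c w
    using that by (induction w arbitrary: c) (simp_all add: words_Cons act lab)
  show loop: "loop_word y \<in> words (cactus_gens 4)" if "y \<in> one_gens" for y
    using check_loops that unfolding list_all_iff words_letter_gen cactus_gens_4 by auto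
  show "foldl coset_act [1, 2, 3, 4] (loop_word y) = [1, 2, 3, 4]" if "y \<in> one_gens" for y
    using check_loops that unfolding list_all_iff by auto
  show "(label_word coset_act coset_label [1, 2, 3, 4] (loop_word y), [Pos y]) \<in> ?Q"
    if "y \<in> one_gens" for y
  proof -
    have "free_reduce (label_word coset_act coset_label [1, 2, 3, 4] (loop_word y)) = [Pos y]"
      using check_loops that unfolding list_all_iff by auto
    with pres_rel_free_reduce[OF lab_word[OF base loop[OF that]], of one_rels]
    show ?thesis by (simp only:)
  qed
  have rel: "foldl coset_act c u = foldl coset_act c v
      \<and> (label_word coset_act coset_label c u, label_word coset_act coset_label c v) \<in> ?Q"
    if "c \<in> set cosets" "u \<in> words (cactus_gens 4)" "v \<in> words (cactus_gens 4)"
      "check_relation c u v" for c u v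
  proof -
    note words = lab_word[OF that(1,2)] lab_word[OF that(1,3)]
    have "(label_word coset_act coset_label c u
        @ inv_word (label_word coset_act coset_label c v), []) \<in> ?Q"
      by (rule conjugate_or_trivialD[OF relator_pres_rel])
        (use that(4) words in \<open>simp_all add: check_relation_def\<close>)
    then show ?thesis
      using that(4) pres_rel_iff_relator[OF words] unfolding check_relation_def by blast
  qed
  \<comment> \<open>An ordered pair serves at most one relation. Pairs that overlap without nesting,
    or whose first interval lies properly inside the second, pass without a check.\<close>
  have pair: "check_pair c x y"
    if "c \<in> set cosets" "x \<in> cactus_gens 4" "y \<in> cactus_gens 4" for c x y
    using check_relations that
    by (simp add: cactus_gens_4 list_all_iff check_relations_def check_row_def)
  have check_square: "check_relation c [Pos x, Pos x] []" if "c \<in> set cosets" "x \<in> cactus_gens 4" for c x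
    using pair[OF that that(2)] by (simp add: check_pair_def)
  have square_rel: "coset_act (coset_act c (Pos x)) (Pos x) = c"
      "(coset_label c (Pos x) @ coset_label (coset_act c (Pos x)) (Pos x), []) \<in> ?Q"
    if "c \<in> set cosets" "x \<in> cactus_gens 4" for c x
    using rel[OF that(1) _ _ check_square[OF that]] that(2) by (simp_all add: words_Cons)
  \<comment> \<open>A letter and its inverse act alike and have the same label, so both conditions
    reduce to the square of a generator.\<close>
  show "coset_act (coset_act c l) (inv_letter l) = c"
    and "(coset_label c l @ coset_label (coset_act c l) (inv_letter l), []) \<in> ?Q"
    if "c \<in> set cosets" "l \<in> letters (cactus_gens 4)" for c l
    using square_rel[OF that(1), of "letter_gen l"] that(2)
    by (cases l; simp add: coset_act_Neg coset_label_Neg)+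
  have rels: "foldl coset_act c u = foldl coset_act c v
      \<and> (label_word coset_act coset_label c u, label_word coset_act coset_label c v) \<in> ?Q"
    if c: "c \<in> set cosets" and uv: "(u, v) \<in> cactus_rels 4" for c u v
  proof -
    have words: "u \<in> words (cactus_gens 4)" "v \<in> words (cactus_gens 4)"
      using cactus_rels_words uv by auto
    consider (square) x where "u = [Pos x, Pos x]" "v = []" "x \<in> cactus_gens 4"
      | (disjoint) p q m r where "u = [s p q, s m r]" "v = [s m r, s p q]"
          "(p, q) \<in> cactus_gens 4" "(m, r) \<in> cactus_gens 4" "{p..q} \<inter> {m..r} = {}"
      | (contained) p q m r where "u = [s p q, s m r]" "v = [s (p + q - r) (p + q - m), s p q]"
          "(p, q) \<in> cactus_gens 4" "(m, r) \<in> cactus_gens 4" "{m..r} \<subseteq> {p..q}"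
      using uv unfolding cactus_rels_def by blast
    then show ?thesis
    proof cases
      case square
      then show ?thesis using rel[OF c words] check_square[OF c] by simp
    next
      case disjoint
      then have "q < m \<or> r < p" "(p, q) \<noteq> (m, r)"
        by (auto simp: cactus_gens_def)
      with pair[OF c disjoint(3,4)] have "check_relation c u v"
        by (auto simp: check_pair_def disjoint)
      then show ?thesis by (rule rel[OF c words])
    next
      case contained
      then have pq: "p \<le> m" "r \<le> q" "\<not> (q < m \<or> r < p)" "p < q" "m < r"
        by (auto simp: cactus_gens_def)
      show ?thesis
      proof (cases "(p, q) = (m, r)")
        \<comment> \<open>The nesting relation also admits equal intervals, where its two sides
          coincide; \<open>check_pair\<close> tests the square in this case.\<close>
        case True
        with contained have "u = v" by simp
        then show ?thesis using lab_word[OF c words(2)] by (simp add: pres_rel.refl)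
      next
        case False
        with pair[OF c contained(3,4)] pq have "check_relation c u v"
          by (auto simp: check_pair_def contained)
        then show ?thesis by (rule rel[OF c words])
      qed
    qed
  qed
  show "foldl coset_act c u = foldl coset_act c v"
    and "(label_word coset_act coset_label c u, label_word coset_act coset_label c v) \<in> ?Q"
    if "c \<in> set cosets" "(u, v) \<in> cactus_rels 4" for c u v
    using rels[OF that] by simp_all
  show "(subst_word loop_word u, subst_word loop_word v) \<in> ?P" if "(u, v) \<in> one_rels" for u v
    using that cactus_trivialD[OF subst_word_words[OF loop relator_words] check_loop_relator]
    by simp
  show "(coset_word c @ [l], subst_word loop_word (coset_label c l) @ coset_word (coset_act c l)) \<in> ?P"
    if "c \<in> set cosets" "l \<in> letters (cactus_gens 4)" for c l
  proof -
    let ?x = "letter_gen l"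
    let ?w = "subst_word loop_word (coset_label c (Pos ?x)) @ coset_word (coset_act c (Pos ?x))"
    have x: "?x \<in> set gen_list" by (rule gen[OF that(2)])
    then have pos: "Pos ?x \<in> letters (cactus_gens 4)" by (simp add: cactus_gens_4)
    have c: "coset_word c \<in> words (cactus_gens 4)" by (rule rep[OF that(1)])
    have w: "?w \<in> words (cactus_gens 4)"
      using subst_word_words[OF loop lab[OF that(1) pos]] rep[OF act[OF that(1) pos]] by simp
    have cx: "coset_word c @ [Pos ?x] \<in> words (cactus_gens 4)"
      using c pos by (simp add: words_Cons)
    have "check_coset_word c ?x"
      using check_coset_words that(1) x by (simp add: list_all_iff check_coset_words_def)
    then have "((coset_word c @ [Pos ?x]) @ inv_word ?w, []) \<in> ?P"
      unfolding check_coset_word_def using cx w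
      by (intro cactus_trivialD) (simp_all add: words_Cons)
    then have "(coset_word c @ [Pos ?x], ?w) \<in> ?P"
      using pres_rel_iff_relator[OF cx w] by blast
    moreover have "[l] \<in> words (cactus_gens 4)" using that(2) by (simp add: words_Cons)
    from pres_rel.append[OF pres_rel.refl[OF c] pres_rel_letter_gen[OF this]]
    have "(coset_word c @ [l], coset_word c @ [Pos ?x]) \<in> ?P" by simp
    ultimately have "(coset_word c @ [l], ?w) \<in> ?P" by (rule pres_rel.trans[rotated])
    then show ?thesis by (simp only: act_gen[of c l] label_gen[of c l])
  qed
qed

lemma one_relator_iso:
  "presented_group (one_gens, one_rels) \<cong> pure_cactus_group 4"
  unfolding pure_cactus_group_4 by (rule PJ.iso_stabilizer)


section \<open>Equivalence of the two presentations\<close>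

text \<open>The five relators of length three, solved for the generators to be eliminated. The word
  for 6 is expanded by those for 5 and 1, so that only surviving generators occur.\<close>

definition definitions :: "(nat \<times> nat gword) list" where
  "definitions = [(1, [g 2, g 10]), (3, [g 4, g 8]), (5, [g 4, g 9]),
     (6, [g 4, g 9, g 2, g 10]), (7, [g 8, g 10])]"

definition expand :: "nat \<Rightarrow> nat gword" where
  "expand y = (case map_of definitions y of None \<Rightarrow> [Pos y] | Some w \<Rightarrow> w)"

lemma pres_rel_expand:
  assumes defs: "\<And>y v. (y, v) \<in> set definitions \<Longrightarrow> ([Pos y], v) \<in> pres_rel {1..10} R"
    and w: "w \<in> words {1..10}"
  shows "(w, subst_word expand w) \<in> pres_rel {1..10} R"
proof (rule pres_rel_subst_definitions[OF _ w])
  show "([Pos y], expand y) \<in> pres_rel {1..10} R" if "y \<in> {1..10}" for y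
    using that defs by (auto simp: expand_def words_Cons intro: pres_rel.refl
        split: option.split dest: map_of_SomeD)
qed

lemma ten_gens: "{1..10} = set [1, 2, 3, 4, 5, 6, 7, 8, 9, 10 :: nat]"
  by code_simp

text \<open>The presentations meet in \<open>?D\<close> over all ten generators, the single relator
  together with the five definitions: one side adds generators, the other exchanges relation sets
  with the same consequences.\<close>

lemma tietze_equivalent_presentations:
  "tietze_equivalent ten_generator_presentation one_relator_presentation"
proof -
  let ?X = "{1..10} :: nat set"
  let ?defs = "(\<lambda>(y, w). ([Pos y], w)) ` set definitions"
  let ?D = "one_rels \<union> ?defs"
  let ?T = "snd ten_generator_presentation"
  have T_words: "?T \<subseteq> words ?X \<times> words ?X" and T_finite: "finite ?T"
    by (simp_all add: ten_generator_presentation_def words_Cons)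
  have relator: "relator \<in> words ?X" by (simp add: words_Cons)
  have defs_words: "([Pos y], w) \<in> words ?X \<times> words ?X" if "(y, w) \<in> set definitions" for y w
    using that by (auto simp: definitions_def words_Cons)
  have "?X = one_gens \<union> fst ` set definitions"
    unfolding ten_gens by (auto simp: definitions_def)
  moreover have "tietze_equivalent (one_gens, one_rels) (one_gens \<union> fst ` set definitions, ?D)"
  proof (rule tietze_add_generators)
    show "one_rels \<subseteq> words one_gens \<times> words one_gens" using relator_words by simp
  qed (auto simp: definitions_def words_Cons)
  ultimately have one: "tietze_equivalent (one_gens, one_rels) (?X, ?D)" by simp
  have "tietze_equivalent (?X, ?D) (?X, ?T)"
  proof (rule tietze_replace_relations)
    let ?P = "pres_rel ?X ?T" and ?Q = "pres_rel ?X ?D"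
    have T: "(r, []) \<in> ?P" if "(r, []) \<in> ?T" for r
      using that T_words by (intro pres_rel.relation) auto
    \<comment> \<open>Solving a relator for one of its letters gives a rotation of the relator or of
      its inverse.\<close>
    have def: "([Pos y], w) \<in> ?P"
      if "(r, []) \<in> ?T" "conjugate_or_trivial r ([Pos y] @ inv_word w)"
        "[Pos y] \<in> words ?X" "w \<in> words ?X" for r y w
    proof -
      have "([Pos y] @ inv_word w, []) \<in> ?P"
        using that by (intro conjugate_or_trivialD[OF T[OF that(1)]]) (simp_all add: words_Cons)
      then show ?thesis using pres_rel_iff_relator[OF that(3,4)] by blast
    qed
    have g1: "([g 1], [g 2, g 10]) \<in> ?P"
    proof (rule def)
      show "([g 10, g_inv 1, g 2], []) \<in> ?T" by (simp add: ten_generator_presentation_def)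
    qed (code_simp, simp_all add: words_Cons)
    have g3: "([g 3], [g 4, g 8]) \<in> ?P"
    proof (rule def)
      show "([g 3, g_inv 8, g_inv 4], []) \<in> ?T" by (simp add: ten_generator_presentation_def)
    qed (code_simp, simp_all add: words_Cons)
    have g5: "([g 5], [g 4, g 9]) \<in> ?P"
    proof (rule def)
      show "([g 5, g_inv 9, g_inv 4], []) \<in> ?T" by (simp add: ten_generator_presentation_def)
    qed (code_simp, simp_all add: words_Cons)
    have g7: "([g 7], [g 8, g 10]) \<in> ?P"
    proof (rule def)
      show "([g 8, g 10, g_inv 7], []) \<in> ?T" by (simp add: ten_generator_presentation_def)
    qed (code_simp, simp_all add: words_Cons)
    \<comment> \<open>The word stays split into two factors so that the definitions of both can be
      appended.\<close>
    have "([g 6], [g 5] @ [g 1]) \<in> ?P"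
    proof (rule def)
      show "([g 5, g 1, g_inv 6], []) \<in> ?T" by (simp add: ten_generator_presentation_def)
    qed (code_simp, simp_all add: words_Cons)
    from pres_rel.trans[OF this pres_rel.append[OF g5 g1]]
    have g6: "([g 6], [g 4, g 9, g 2, g 10]) \<in> ?P" by simp
    have defs: "([Pos y], w) \<in> ?P" if "(y, w) \<in> set definitions" for y w
      using that g1 g3 g5 g6 g7 by (auto simp: definitions_def)
    let ?r = "[g 3, g_inv 6, g 7, g_inv 9, g_inv 2]"
    have r: "(?r, []) \<in> ?P" by (rule T) (simp add: ten_generator_presentation_def)
    then have "?r \<in> words ?X" using pres_rel_words by blast
    from pres_rel.sym[OF pres_rel_expand[OF defs this]] r
    have "(subst_word expand ?r, []) \<in> ?P" by (rule pres_rel.trans)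
    \<comment> \<open>The expansion is, letter by letter, the inverse of \<open>relator\<close>;
      here it takes the role of the given relator.\<close>
    moreover have "conjugate_or_trivial (subst_word expand ?r) relator" by code_simp
    ultimately have "(relator, []) \<in> ?P" by (rule conjugate_or_trivialD[OF _ relator])
    with defs show "?D \<subseteq> ?P" by auto
    have defs_D: "([Pos y], w) \<in> ?Q" if "(y, w) \<in> set definitions" for y w
      using that defs_words[OF that] by (intro pres_rel.relation) auto
    have relator_D: "(relator, []) \<in> ?Q"
      using relator by (intro pres_rel.relation) auto
    have "(r, []) \<in> ?Q" if "r \<in> words ?X" "conjugate_or_trivial relator (subst_word expand r)" for r
    proof -
      note 1 = pres_rel_expand[OF defs_D that(1)]
      from pres_rel_words[OF 1] have "subst_word expand r \<in> words ?X" by simp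
      from pres_rel.trans[OF 1 conjugate_or_trivialD[OF relator_D this that(2)]] show ?thesis .
    qed
    \<comment> \<open>The first word expands to the inverse of \<open>relator\<close>, and the five
      others cancel freely.\<close>
    moreover have "list_all (\<lambda>r. conjugate_or_trivial relator (subst_word expand r))
      [[g 3, g_inv 6, g 7, g_inv 9, g_inv 2], [g 3, g_inv 8, g_inv 4], [g 5, g_inv 9, g_inv 4],
       [g 5, g 1, g_inv 6], [g 8, g 10, g_inv 7], [g 10, g_inv 1, g 2]]"
      by code_simp
    ultimately show "?T \<subseteq> ?Q"
      using T_words by (simp add: ten_generator_presentation_def)
  qed (use T_finite in auto)
  with one have "tietze_equivalent (one_gens, one_rels) (?X, ?T)"
    by (rule tietze_equivalent_trans)
  moreover have "(?X, ?T) = ten_generator_presentation"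
    by (simp add: ten_generator_presentation_def)
  ultimately show ?thesis
    by (simp only: one_relator_presentation_def tietze_equivalent_sym)
qed

theorem theorem1p1:
  shows "pure_cactus_group 4 \<cong> presented_group ten_generator_presentation
    \<and> tietze_equivalent ten_generator_presentation one_relator_presentation
    \<and> pure_cactus_group 4 \<cong> presented_group one_relator_presentation"
proof -
  have one: "pure_cactus_group 4 \<cong> presented_group one_relator_presentation"
    unfolding one_relator_presentation_def
    by (rule group.iso_sym[OF group_presented_group one_relator_iso])
  moreover have "presented_group one_relator_presentation
      \<cong> presented_group ten_generator_presentation"
    by (rule tietze_equivalent_iso[OF tietze_equivalent_sym[OF tietze_equivalent_presentations]])
  ultimately have "pure_cactus_group 4 \<cong> presented_group ten_generator_presentation"
    by (rule iso_trans)
  with one tietze_equivalent_presentations show ?thesis by simp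
qed

end
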